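(* Let $M$ and $N$ be finitely generated monoids, each having only finitely many left ideals and finitely many right ideals, and suppose $M$ and $N$ are quasi-isometric. If $M$ is finitely presented with solvable word problem, then $N$ is finitely presented with solvable word problem.
   Context: For a monoid $S$ generated by a finite set $A$, $d_A(x,y)=\inf\{|w|:w\in A^*,\ xw=y\}$ ($A^*$ the free monoid on $A$, $\inf\emptyset=\infty$). A map $f:(S,d_A)\to(T,d_B)$ is a quasi-isometry if there are $1\le\lambda<\infty$, $0<\epsilon<\infty$, $0\le\mu<\infty$ with $\frac1\lambda d_A(x,y)-\epsilon\le d_B(f(x),f(y))\le\lambda d_A(x,y)+\epsilon$ for all $x,y$, and for each $t\in T$ some $x\in S$ with $\max(d_B(t,f(x)),d_B(f(x),t))\le\mu$. Monoids $S,T$ are quasi-isometric if $(S,d_A)$, $(T,d_B)$ are quasi-isometric for some finite generating sets $A,B$. "Finitely presented with solvable word problem" means the monoid admits a finite presentation for which the word problem is decidable. *)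

theory Defs
  imports "HOL-Algebra.Group" "HOL-Library.Extended_Real" "HOL-Library.Nat_Bijection"
begin

definition mprod :: "('a, 'b) monoid_scheme \<Rightarrow> 'a list \<Rightarrow> 'a" where
  "mprod M w = foldr (\<lambda>a acc. a \<otimes>\<^bsub>M\<^esub> acc) w \<one>\<^bsub>M\<^esub>"

definition generates :: "('a, 'b) monoid_scheme \<Rightarrow> 'a set \<Rightarrow> bool" where
  "generates M A \<longleftrightarrow> A \<subseteq> carrier M \<and> (\<forall>x\<in>carrier M. \<exists>w\<in>lists A. mprod M w = x)"

definition finitely_generated :: "('a, 'b) monoid_scheme \<Rightarrow> bool" where
  "finitely_generated M \<longleftrightarrow> (\<exists>A. finite A \<and> generates M A)"

(* d_A(x,y) = inf { |w| : w \<in> A^*, x w = y }, with inf {} = \<infinity> *)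
definition mdist :: "('a, 'b) monoid_scheme \<Rightarrow> 'a set \<Rightarrow> 'a \<Rightarrow> 'a \<Rightarrow> enat" where
  "mdist M A x y = Inf {enat (length w) | w. w \<in> lists A \<and> x \<otimes>\<^bsub>M\<^esub> mprod M w = y}"

definition qi_map ::
  "('a, 'b) monoid_scheme \<Rightarrow> 'a set \<Rightarrow> ('c, 'd) monoid_scheme \<Rightarrow> 'c set \<Rightarrow> ('a \<Rightarrow> 'c) \<Rightarrow> bool" where
  "qi_map M A N B f \<longleftrightarrow> f ` carrier M \<subseteq> carrier N \<and>
     (\<exists>(lam::real) (\<epsilon>::real) (\<mu>::real). 1 \<le> lam \<and> 0 < \<epsilon> \<and> 0 \<le> \<mu> \<and>
       (\<forall>x\<in>carrier M. \<forall>y\<in>carrier M.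
          ereal (1 / lam) * ereal_of_enat (mdist M A x y) - ereal \<epsilon>
            \<le> ereal_of_enat (mdist N B (f x) (f y)) \<and>
          ereal_of_enat (mdist N B (f x) (f y))
            \<le> ereal lam * ereal_of_enat (mdist M A x y) + ereal \<epsilon>) \<and>
       (\<forall>t\<in>carrier N. \<exists>x\<in>carrier M.
          max (ereal_of_enat (mdist N B t (f x))) (ereal_of_enat (mdist N B (f x) t)) \<le> ereal \<mu>))"

definition quasi_isometric :: "('a, 'b) monoid_scheme \<Rightarrow> ('c, 'd) monoid_scheme \<Rightarrow> bool" where
  "quasi_isometric M N \<longleftrightarrow>
     (\<exists>A B f. finite A \<and> generates M A \<and> finite B \<and> generates N B \<and> qi_map M A N B f)"

definition left_ideals :: "('a, 'b) monoid_scheme \<Rightarrow> 'a set set" where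
  "left_ideals M = {I. I \<noteq> {} \<and> I \<subseteq> carrier M \<and>
      (\<forall>m\<in>carrier M. \<forall>x\<in>I. m \<otimes>\<^bsub>M\<^esub> x \<in> I)}"

definition right_ideals :: "('a, 'b) monoid_scheme \<Rightarrow> 'a set set" where
  "right_ideals M = {I. I \<noteq> {} \<and> I \<subseteq> carrier M \<and>
      (\<forall>m\<in>carrier M. \<forall>x\<in>I. x \<otimes>\<^bsub>M\<^esub> m \<in> I)}"

datatype recf = Zr | Sc | Proj nat | Cn recf "recf list" | Pr recf recf | Mn recf

inductive reval :: "recf \<Rightarrow> nat list \<Rightarrow> nat \<Rightarrow> bool" where
  zero: "reval Zr xs 0"
| suc: "reval Sc (x # xs) (Suc x)"
| proj: "k < length xs \<Longrightarrow> reval (Proj k) xs (xs ! k)"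
| comp: "length ys = length gs \<Longrightarrow> (\<forall>i<length gs. reval (gs ! i) xs (ys ! i)) \<Longrightarrow>
          reval f ys z \<Longrightarrow> reval (Cn f gs) xs z"
| prim0: "reval f xs y \<Longrightarrow> reval (Pr f g) (0 # xs) y"
| primS: "reval (Pr f g) (n # xs) y \<Longrightarrow> reval g (y # n # xs) z \<Longrightarrow>
          reval (Pr f g) (Suc n # xs) z"
| mu: "reval f (n # xs) 0 \<Longrightarrow> (\<forall>i<n. \<exists>y. 0 < y \<and> reval f (i # xs) y) \<Longrightarrow>
          reval (Mn f) xs n"

definition decidable_set :: "nat set \<Rightarrow> bool" where
  "decidable_set P \<longleftrightarrow> (\<exists>f. \<forall>x. (x \<in> P \<longrightarrow> reval f [x] 0) \<and> (x \<notin> P \<longrightarrow> reval f [x] 1))"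

definition rstep :: "('x list \<times> 'x list) set \<Rightarrow> ('x list \<times> 'x list) set" where
  "rstep R = {(p @ l @ q, p @ r @ q) | p l r q. (l, r) \<in> R}"

definition cong_gen :: "('x list \<times> 'x list) set \<Rightarrow> ('x list \<times> 'x list) set" where
  "cong_gen R = (rstep R \<union> (rstep R)\<inverse>)\<^sup>*"

(* M has a finite presentation <x_0,...,x_{n-1} | R> (via g : x_i \<mapsto> g i) whose
   word problem is decidable *)
definition fp_solvable_wp :: "('a, 'b) monoid_scheme \<Rightarrow> bool" where
  "fp_solvable_wp M \<longleftrightarrow>
    (\<exists>(n::nat) (g::nat \<Rightarrow> 'a) (R::(nat list \<times> nat list) set).
       g ` {..<n} \<subseteq> carrier M \<and>
       (\<forall>m\<in>carrier M. \<exists>w\<in>lists {..<n}. mprod M (map g w) = m) \<and>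
       finite R \<and> R \<subseteq> lists {..<n} \<times> lists {..<n} \<and>
       (\<forall>u\<in>lists {..<n}. \<forall>v\<in>lists {..<n}.
          mprod M (map g u) = mprod M (map g v) \<longleftrightarrow> (u, v) \<in> cong_gen R) \<and>
       decidable_set {prod_encode (list_encode u, list_encode v) | u v.
          u \<in> lists {..<n} \<and> v \<in> lists {..<n} \<and> mprod M (map g u) = mprod M (map g v)})"

end

theory Submission
  imports Defs
begin

text \<open>
  Call two words over the generators related by a \<open>K\<close>-move if they have the form \<open>p l q\<close> and
  \<open>p r q\<close> with \<open>l\<close>, \<open>r\<close> of length at most \<open>K\<close> and \<open>p l = p r\<close> in the monoid. For a finitely
  presented monoid there is a \<open>K\<close> such that any two words with the same value are connected by
  \<open>K\<close>-moves. This is a condition on directed paths in the right Cayley graph, and it is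
  carried over by a quasi-isometry together with the number of moves: the image of a path under
  the quasi-inverse and back is joined to the path by a ladder of bounded cells.
  Conversely, if there are only finitely many \<open>\<L>\<close>-classes, then \<open>p l = p r\<close> depends on \<open>p\<close> only
  through a representative of its \<open>\<L>\<close>-class, so that finitely many relations realise all
  \<open>K\<close>-moves and the monoid is finitely presented.

  For a finite presentation, the word problem is decidable if and only if the number of relation
  applications needed to connect equal words is bounded by a computable function of their
  length (one searches for a derivation), and the passage above changes this bound only
  polynomially.
\<close>

section \<open>Computable functions\<close>

text \<open>Fixing only the length of the argument list lets a function be written as an ordinary
  expression in \<open>xs\<close>, so that computability is proved by following its syntax with
  \<open>computable_intros\<close>.\<close>

definition computable :: "nat \<Rightarrow> (nat list \<Rightarrow> nat) \<Rightarrow> bool" where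
  "computable k f \<longleftrightarrow> (\<exists>r. \<forall>xs. length xs = k \<longrightarrow> reval r xs (f xs))"

text \<open>Truth is coded by 0, in agreement with \<open>decidable_set\<close> and with the zero
  test of \<open>Mn\<close>.\<close>

definition computable_pred :: "nat \<Rightarrow> (nat list \<Rightarrow> bool) \<Rightarrow> bool" where
  "computable_pred k P \<longleftrightarrow> computable k (\<lambda>xs. if P xs then 0 else 1)"

named_theorems computable_intros

lemma computable_cong:
  "computable k f \<Longrightarrow> (\<And>xs. length xs = k \<Longrightarrow> f xs = g xs) \<Longrightarrow> computable k g"
  unfolding computable_def by metis

lemma computable_pred_cong:
  "computable_pred k P \<Longrightarrow> (\<And>xs. length xs = k \<Longrightarrow> P xs = Q xs) \<Longrightarrow> computable_pred k Q"
  unfolding computable_pred_def by (erule computable_cong) auto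

lemma computable_nth [computable_intros]: "i < k \<Longrightarrow> computable k (\<lambda>xs. xs ! i)"
  unfolding computable_def using reval.proj by blast

lemma computable_compose:
  assumes "computable m f" "length gs = m" "\<And>g. g \<in> set gs \<Longrightarrow> computable k g"
  shows "computable k (\<lambda>xs. f (map (\<lambda>g. g xs) gs))"
proof -
  obtain rf where rf: "\<And>ys. length ys = m \<Longrightarrow> reval rf ys (f ys)"
    using assms(1) unfolding computable_def by blast
  \<comment> \<open>The argument functions form a list of arbitrary length, so one program for each
    is chosen simultaneously.\<close>
  define rg where "rg g = (SOME r. \<forall>xs. length xs = k \<longrightarrow> reval r xs (g xs))" for g
  have rg: "reval (rg g) xs (g xs)" if "g \<in> set gs" "length xs = k" for g xs
    using someI_ex[of "\<lambda>r. \<forall>xs. length xs = k \<longrightarrow> reval r xs (g xs)"] assms(3)[OF that(1)] that(2)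
    unfolding computable_def rg_def by blast
  have "reval (Cn rf (map rg gs)) xs (f (map (\<lambda>g. g xs) gs))" if "length xs = k" for xs
    by (rule reval.comp[where ys = "map (\<lambda>g. g xs) gs"]) (use assms(2) that rf rg in auto)
  then show ?thesis unfolding computable_def by blast
qed

lemma computable_compose1:
  assumes "computable 1 (\<lambda>xs. f (xs ! 0))" "computable k a"
  shows "computable k (\<lambda>xs. f (a xs))"
  using computable_compose[OF assms(1), of "[a]" k] assms(2) by simp

lemma computable_compose2:
  assumes "computable 2 (\<lambda>xs. f (xs ! 0) (xs ! 1))" "computable k a" "computable k b"
  shows "computable k (\<lambda>xs. f (a xs) (b xs))"
  using computable_compose[OF assms(1), of "[a, b]" k] assms(2,3) by auto

lemma computable_pred_compose1:
  assumes "computable_pred 1 (\<lambda>xs. P (xs ! 0))" "computable k a"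
  shows "computable_pred k (\<lambda>xs. P (a xs))"
  using computable_compose1[of "\<lambda>x. if P x then 0 else 1"] assms unfolding computable_pred_def by simp

lemma computable_pred_compose2:
  assumes "computable_pred 2 (\<lambda>xs. P (xs ! 0) (xs ! 1))" "computable k a" "computable k b"
  shows "computable_pred k (\<lambda>xs. P (a xs) (b xs))"
  using computable_compose2[of "\<lambda>x y. if P x y then 0 else 1"] assms unfolding computable_pred_def by simp

text \<open>Composing with the projections to the positions 1 to \<open>k\<close> ignores the first
  argument. This is the weakening needed when a binder puts a new variable in front.\<close>

lemma computable_tl:
  assumes "computable k f"
  shows "computable (Suc k) (\<lambda>xs. f (tl xs))"
proof -
  have "computable (Suc k) (\<lambda>xs. f (map (\<lambda>g. g xs) (map (\<lambda>i xs. xs ! Suc i) [0..<k])))"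
    by (rule computable_compose[OF assms]) (auto intro: computable_nth)
  then show ?thesis
  proof (rule computable_cong)
    fix xs :: "nat list" assume "length xs = Suc k"
    then have "map (\<lambda>g. g xs) (map (\<lambda>i xs. xs ! Suc i) [0..<k]) = tl xs"
      by (intro nth_equalityI) (auto simp: nth_tl)
    then show "f (map (\<lambda>g. g xs) (map (\<lambda>i xs. xs ! Suc i) [0..<k])) = f (tl xs)" by simp
  qed
qed

lemma computable_hd: "0 < k \<Longrightarrow> computable k (\<lambda>xs. hd xs)"
  by (rule computable_cong[OF computable_nth[of 0]]) (auto simp: hd_conv_nth)

text \<open>Binders extend the argument list at the front, so that the variables of a nested
  expression are accessed through iterated tails.\<close>

lemma computable_hd_tls [computable_intros]:
  "0 < k \<Longrightarrow> computable k (\<lambda>xs. hd xs)"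
  "1 < k \<Longrightarrow> computable k (\<lambda>xs. hd (tl xs))"
  "2 < k \<Longrightarrow> computable k (\<lambda>xs. hd (tl (tl xs)))"
  using computable_hd[of k] computable_hd[of "k - 1"] computable_hd[of "k - 2"]
    computable_tl[of "k - 1" hd] computable_tl[of "k - 2" hd]
    computable_tl[of "k - 1" "\<lambda>xs. hd (tl xs)"]
  by (auto simp: eval_nat_numeral Suc_diff_Suc)

lemma computable_nth_tls [computable_intros]:
  "Suc i < k \<Longrightarrow> computable k (\<lambda>xs. tl xs ! i)"
  "Suc (Suc i) < k \<Longrightarrow> computable k (\<lambda>xs. tl (tl xs) ! i)"
  using computable_tl[of "k - 1" "\<lambda>xs. xs ! i"] computable_nth[of i "k - 1"]
    computable_tl[of "k - 1" "\<lambda>xs. tl xs ! i"] computable_tl[of "k - 2" "\<lambda>xs. xs ! i"]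
    computable_nth[of i "k - 2"]
  by (auto simp: eval_nat_numeral Suc_diff_Suc)

lemma computable_Suc [computable_intros]:
  assumes "computable k f" shows "computable k (\<lambda>xs. Suc (f xs))"
proof -
  have "computable 1 (\<lambda>xs. Suc (xs ! 0))"
    unfolding computable_def by (rule exI[of _ Sc]) (auto simp: length_Suc_conv intro: reval.suc)
  from computable_compose1[OF this assms] show ?thesis .
qed

lemma computable_const [computable_intros]: "computable k (\<lambda>xs. c)"
proof (induction c)
  case 0
  then show ?case unfolding computable_def using reval.zero by blast
qed (rule computable_Suc)

lemma reval_Pr:
  assumes "reval rf xs a" "\<And>m y. reval rg (y # m # xs) (g y m)"
  shows "reval (Pr rf rg) (n # xs) (rec_nat a (\<lambda>m y. g y m) n)"
  by (induction n) (auto intro: reval.prim0 reval.primS assms)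

lemma computable_rec_nat [computable_intros]:
  assumes "computable k f" "computable (Suc (Suc k)) (\<lambda>ys. g (hd ys) (hd (tl ys)) (tl (tl ys)))"
    and n: "computable k n"
  shows "computable k (\<lambda>xs. rec_nat (f xs) (\<lambda>m y. g y m xs) (n xs))"
proof -
  obtain rf where rf: "\<And>xs. length xs = k \<Longrightarrow> reval rf xs (f xs)"
    using assms(1) unfolding computable_def by blast
  obtain rg where rg: "\<And>ys. length ys = Suc (Suc k) \<Longrightarrow> reval rg ys (g (hd ys) (hd (tl ys)) (tl (tl ys)))"
    using assms(2) unfolding computable_def by blast
  have "reval (Pr rf rg) (m # xs) (rec_nat (f xs) (\<lambda>m y. g y m xs) m)" if "length xs = k" for m xs
    by (rule reval_Pr) (use that rf rg[of "_ # _ # xs"] in auto)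
  then have *: "computable (Suc k) (\<lambda>ys. rec_nat (f (tl ys)) (\<lambda>m y. g y m (tl ys)) (hd ys))"
    unfolding computable_def by (intro exI[of _ "Pr rf rg"]) (auto simp: length_Suc_conv)
  \<comment> \<open>\<open>Pr\<close> recurses on the first argument. Composing with
    \<open>n\<close> followed by all projections puts \<open>n xs\<close> in front of
    \<open>xs\<close>.\<close>
  let ?gs = "n # map (\<lambda>i xs. xs ! i) [0..<k]"
  have "computable k (\<lambda>xs. (\<lambda>ys. rec_nat (f (tl ys)) (\<lambda>m y. g y m (tl ys)) (hd ys)) (map (\<lambda>g. g xs) ?gs))"
    by (rule computable_compose[OF *]) (auto intro: computable_nth n)
  then show ?thesis
  proof (rule computable_cong)
    fix xs :: "nat list" assume "length xs = k"
    then have "map (\<lambda>g. g xs) (map (\<lambda>i xs. xs ! i) [0..<k]) = xs"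
      by (intro nth_equalityI) auto
    then show "rec_nat (f (tl (map (\<lambda>g. g xs) ?gs))) (\<lambda>m y. g y m (tl (map (\<lambda>g. g xs) ?gs)))
        (hd (map (\<lambda>g. g xs) ?gs)) = rec_nat (f xs) (\<lambda>m y. g y m xs) (n xs)"
      by simp
  qed
qed

text \<open>A recursion whose step ignores its arguments is a case distinction on whether the
  counter is 0, that is, on the coded truth value.\<close>

lemma computable_if [computable_intros]:
  assumes "computable_pred k P" "computable k a" "computable k b"
  shows "computable k (\<lambda>xs. if P xs then a xs else b xs)"
proof -
  have *: "computable 3 (\<lambda>xs. rec_nat (xs ! 1) (\<lambda>m y. xs ! 2) (xs ! 0))"
    by (rule computable_rec_nat) (intro computable_intros; simp)+
  have "computable k (\<lambda>xs. rec_nat (a xs) (\<lambda>m y. b xs) (if P xs then 0 else 1))"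
    using computable_compose[OF *, of "[\<lambda>xs. if P xs then 0 else 1, a, b]" k] assms
    unfolding computable_pred_def by (auto simp: eval_nat_numeral)
  then show ?thesis by (rule computable_cong) auto
qed

lemma computable_pred_not [computable_intros]:
  assumes "computable_pred k P" shows "computable_pred k (\<lambda>xs. \<not> P xs)"
proof -
  have "computable k (\<lambda>xs. if P xs then 1 else 0)"
    by (intro computable_intros assms)
  then show ?thesis unfolding computable_pred_def by (rule computable_cong) auto
qed

lemma computable_pred_conj [computable_intros]:
  assumes "computable_pred k P" "computable_pred k Q" shows "computable_pred k (\<lambda>xs. P xs \<and> Q xs)"
proof -
  have "computable k (\<lambda>xs. if P xs then if Q xs then 0 else 1 else 1)"
    by (intro computable_intros assms)
  then show ?thesis unfolding computable_pred_def by (rule computable_cong) auto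
qed

lemma computable_pred_disj [computable_intros]:
  assumes "computable_pred k P" "computable_pred k Q" shows "computable_pred k (\<lambda>xs. P xs \<or> Q xs)"
proof -
  have "computable k (\<lambda>xs. if P xs then 0 else if Q xs then 0 else 1)"
    by (intro computable_intros assms)
  then show ?thesis unfolding computable_pred_def by (rule computable_cong) auto
qed

lemma computable_pred_const [computable_intros]: "computable_pred k (\<lambda>xs. c)"
  unfolding computable_pred_def by (rule computable_const)

lemma computable_pred_All_less [computable_intros]:
  assumes P: "computable_pred (Suc k) (\<lambda>ys. P (hd ys) (tl ys))" and n: "computable k n"
  shows "computable_pred k (\<lambda>xs. \<forall>i<n xs. P i xs)"
proof -
  \<comment> \<open>The step function of \<open>Pr\<close> receives the previous value before the
    counter, so \<open>P\<close> has to be shifted past one more variable.\<close>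
  have "computable_pred (Suc (Suc k)) (\<lambda>ys. P (hd (tl ys)) (tl (tl ys)))"
    using computable_tl[of "Suc k" "\<lambda>ys. if P (hd ys) (tl ys) then 0 else 1"] P 
    unfolding computable_pred_def by simp
  then have *: "computable k (\<lambda>xs. rec_nat 0 (\<lambda>m y. if P m xs then y else 1) (n xs))"
    by (intro computable_intros n) simp_all
  \<comment> \<open>Once some \<open>i\<close> has failed, the value is 1 and stays 1.\<close>
  have "rec_nat 0 (\<lambda>m y. if P m xs then y else 1) l = (if \<forall>i<l. P i xs then 0 else 1::nat)" for l xs
    by (induction l) (auto simp: less_Suc_eq)
  with * show ?thesis unfolding computable_pred_def by simp
qed

lemma computable_pred_Ex_less [computable_intros]:
  assumes P: "computable_pred (Suc k) (\<lambda>ys. P (hd ys) (tl ys))" and n: "computable k n"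
  shows "computable_pred k (\<lambda>xs. \<exists>i<n xs. P i xs)"
proof -
  have "computable_pred k (\<lambda>xs. \<not> (\<forall>i<n xs. \<not> P i xs))"
    by (intro computable_intros assms)
  then show ?thesis by simp
qed

text \<open>This is unbounded search: \<open>ex\<close> makes it terminate, and totality of the
  predicate provides the positive values that \<open>Mn\<close> demands below the result.\<close>

lemma computable_Least [computable_intros]:
  assumes P: "computable_pred (Suc k) (\<lambda>ys. P (hd ys) (tl ys))"
    and ex: "\<And>xs. length xs = k \<Longrightarrow> \<exists>n. P n xs"
  shows "computable k (\<lambda>xs. LEAST n. P n xs)"
proof -
  obtain r where r: "\<And>ys. length ys = Suc k \<Longrightarrow> reval r ys (if P (hd ys) (tl ys) then 0 else 1)"
    using P unfolding computable_def computable_pred_def by blast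
  have "reval (Mn r) xs (LEAST n. P n xs)" if "length xs = k" for xs
  proof (rule reval.mu)
    show "reval r ((LEAST n. P n xs) # xs) 0"
      using r[of "(LEAST n. P n xs) # xs"] LeastI_ex[OF ex[OF that]] that by simp
    show "\<forall>i<LEAST n. P n xs. \<exists>y>0. reval r (i # xs) y"
    proof (intro allI impI)
      fix i assume "i < (LEAST n. P n xs)"
      then have "\<not> P i xs" by (rule not_less_Least)
      then show "\<exists>y>0. reval r (i # xs) y" using r[of "i # xs"] that by (intro exI[of _ 1]) simp
    qed
  qed
  then show ?thesis unfolding computable_def by blast
qed

section \<open>Arithmetic, comparisons and pairing\<close>

lemma computable_add [computable_intros]:
  assumes "computable k a" "computable k b" shows "computable k (\<lambda>xs. a xs + b xs)"
proof -
  have *: "computable 2 (\<lambda>xs. rec_nat (xs ! 1) (\<lambda>m y. Suc y) (xs ! 0))"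
    by (intro computable_intros) simp_all
  have "rec_nat j (\<lambda>m y. Suc y) i = i + j" for i j :: nat by (induction i) auto
  with computable_compose2[OF * assms] show ?thesis by simp
qed

lemma computable_mult [computable_intros]:
  assumes "computable k a" "computable k b" shows "computable k (\<lambda>xs. a xs * b xs)"
proof -
  have *: "computable 2 (\<lambda>xs. rec_nat 0 (\<lambda>m y. y + xs ! 1) (xs ! 0))"
    by (intro computable_intros) simp_all
  have "rec_nat 0 (\<lambda>m y. y + j) i = i * j" for i j :: nat by (induction i) auto
  with computable_compose2[OF * assms] show ?thesis by simp
qed

lemma computable_diff [computable_intros]:
  assumes "computable k a" "computable k b" shows "computable k (\<lambda>xs. a xs - b xs)"
proof -
  \<comment> \<open>The predecessor comes first: a recursion that returns its counter. Subtraction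
    then iterates it.\<close>
  have "computable 1 (\<lambda>xs. rec_nat 0 (\<lambda>m y. m) (xs ! 0))"
    by (intro computable_intros) simp_all
  moreover have "rec_nat 0 (\<lambda>m y. m) i = i - 1" for i :: nat by (cases i) auto
  ultimately have "computable 1 (\<lambda>xs. xs ! 0 - 1)" by simp
  from computable_compose1[OF this]
  have pred: "computable k (\<lambda>xs. f xs - 1)" if "computable k f" for f k using that by simp
  have *: "computable 2 (\<lambda>xs. rec_nat (xs ! 0) (\<lambda>m y. y - 1) (xs ! 1))"
    by (intro computable_intros pred) simp_all
  have "rec_nat i (\<lambda>m y. y - 1) j = i - j" for i j :: nat by (induction j) auto
  with computable_compose2[OF * assms] show ?thesis by simp
qed

lemma computable_pred_le [computable_intros]:
  assumes "computable k a" "computable k b" shows "computable_pred k (\<lambda>xs. a xs \<le> b xs)"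
proof -
  have "computable k (\<lambda>xs. rec_nat 0 (\<lambda>m y. 1) (a xs - b xs))"
    by (rule computable_rec_nat) (intro computable_intros assms)+
  moreover have "rec_nat 0 (\<lambda>m y. 1) (i - j) = (if i \<le> j then 0 else 1 :: nat)" for i j :: nat
    by (cases "i - j") auto
  ultimately show ?thesis unfolding computable_pred_def by simp
qed

lemma computable_pred_less [computable_intros]:
  "computable k a \<Longrightarrow> computable k b \<Longrightarrow> computable_pred k (\<lambda>xs. a xs < b xs)"
  using computable_pred_not[OF computable_pred_le[of k b a]] by (simp add: not_le)

lemma computable_pred_eq [computable_intros]:
  assumes "computable k a" "computable k b" shows "computable_pred k (\<lambda>xs. a xs = b xs)"
proof -
  have "computable_pred k (\<lambda>xs. a xs \<le> b xs \<and> b xs \<le> a xs)"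
    by (intro computable_intros assms)
  then show ?thesis by (simp add: order_eq_iff)
qed

lemma computable_prod_encode [computable_intros]:
  assumes "computable k a" "computable k b" shows "computable k (\<lambda>xs. prod_encode (a xs, b xs))"
proof -
  have "computable 1 (\<lambda>xs. rec_nat 0 (\<lambda>m y. y + Suc m) (xs ! 0))"
    by (intro computable_intros) simp_all
  moreover have "rec_nat 0 (\<lambda>m y. y + Suc m) i = triangle i" for i :: nat by (induction i) auto
  ultimately have *: "computable 1 (\<lambda>xs. triangle (xs ! 0))" by simp
  show ?thesis unfolding prod_encode_def
    using computable_add[OF computable_compose1[OF * computable_add[OF assms]] assms(1)] by simp
qed

text \<open>The pairing is inverted by search. Neither component exceeds the code, so the other
  component may be quantified below \<open>Suc x\<close>.\<close>

lemma computable_fst_prod_decode [computable_intros]: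
  assumes "computable k a" shows "computable k (\<lambda>xs. fst (prod_decode (a xs)))"
proof (rule computable_compose1[OF _ assms])
  have ex: "\<exists>b<Suc x. prod_encode (fst (prod_decode x), b) = x" for x
    by (intro exI[of _ "snd (prod_decode x)"]) 
      (metis le_imp_less_Suc le_prod_encode_2 prod.collapse prod_decode_inverse)
  have "computable 1 (\<lambda>xs. LEAST a. \<exists>b<Suc (xs ! 0). prod_encode (a, b) = xs ! 0)"
    using ex by (intro computable_intros) (simp_all, blast)
  moreover have "(LEAST a. \<exists>b<Suc x. prod_encode (a, b) = x) = fst (prod_decode x)" for x
    by (rule Least_equality) (use ex in auto)
  ultimately show "computable 1 (\<lambda>xs. fst (prod_decode (xs ! 0)))" by simp
qed

lemma computable_snd_prod_decode [computable_intros]: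
  assumes "computable k a" shows "computable k (\<lambda>xs. snd (prod_decode (a xs)))"
proof (rule computable_compose1[OF _ assms])
  have ex: "prod_encode (fst (prod_decode x), snd (prod_decode x)) = x" for x
    by simp
  have "computable 1 (\<lambda>xs. LEAST b. prod_encode (fst (prod_decode (xs ! 0)), b) = xs ! 0)"
    by (intro computable_intros) (auto intro: ex)
  moreover have "(LEAST b. prod_encode (fst (prod_decode x), b) = x) = snd (prod_decode x)" for x
    by (rule Least_equality) (metis ex, metis order_refl prod.sel(2) prod_encode_inverse)
  ultimately show "computable 1 (\<lambda>xs. snd (prod_decode (xs ! 0)))" by simp
qed

section \<open>Derivations and moves\<close>

text \<open>Including \<open>Id\<close> makes the \<open>k\<close>-th power mean at most
  \<open>k\<close> applications of relations. Upper bounds on derivation length may therefore be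
  weakened freely.\<close>

definition sstep :: "('x list \<times> 'x list) set \<Rightarrow> ('x list \<times> 'x list) set" where
  "sstep R = Id \<union> rstep R \<union> (rstep R)\<inverse>"

lemma rstepI: "(l, r) \<in> R \<Longrightarrow> (p @ l @ q, p @ r @ q) \<in> rstep R"
  unfolding rstep_def by blast

lemma rstepE:
  assumes "(u, v) \<in> rstep R"
  obtains p l r q where "u = p @ l @ q" "v = p @ r @ q" "(l, r) \<in> R"
  using assms unfolding rstep_def by blast

lemma cong_gen_eq_relpow: "(u, v) \<in> cong_gen R \<longleftrightarrow> (\<exists>k. (u, v) \<in> sstep R ^^ k)"
proof -
  have "sstep R = (rstep R \<union> (rstep R)\<inverse>)\<^sup>=" unfolding sstep_def by blast
  then have "cong_gen R = (sstep R)\<^sup>*" unfolding cong_gen_def by simp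
  then show ?thesis by (simp add: rtrancl_is_UN_relpow)
qed

lemma relpow_mono_exponent:
  assumes "Id \<subseteq> S" "i \<le> j" shows "S ^^ i \<subseteq> S ^^ j"
  using assms(2)
proof (induction rule: dec_induct)
  case (step j)
  have "S ^^ j \<subseteq> S ^^ Suc j" using assms(1) by (auto intro: relpow_Suc_I)
  then show ?case using step.IH by blast
qed simp

lemma sstep_relpow_mono: "i \<le> j \<Longrightarrow> (u, v) \<in> sstep R ^^ i \<Longrightarrow> (u, v) \<in> sstep R ^^ j"
  using relpow_mono_exponent[of "sstep R" i j] by (auto simp: sstep_def)

lemma relpow_trans: "(u, v) \<in> S ^^ i \<Longrightarrow> (v, w) \<in> S ^^ j \<Longrightarrow> (u, w) \<in> S ^^ (i + j)"
  by (auto simp: relpow_add)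

lemma sym_relpow: "sym S \<Longrightarrow> (u, v) \<in> S ^^ k \<Longrightarrow> (v, u) \<in> S ^^ k"
proof (induction k arbitrary: v)
  case (Suc k)
  then obtain w where "(u, w) \<in> S ^^ k" "(w, v) \<in> S" by auto
  moreover from this Suc.prems(1) have "(v, w) \<in> S" by (simp add: symD)
  ultimately show ?case using Suc.IH[OF Suc.prems(1)] relpow_Suc_I2 by metis
qed simp

lemma sym_sstep: "sym (sstep R)"
  by (auto simp: sstep_def sym_def)

lemma rstep_context:
  assumes "(u, v) \<in> rstep R" shows "(p @ u @ q, p @ v @ q) \<in> rstep R"
proof -
  obtain p' l r q' where *: "u = p' @ l @ q'" "v = p' @ r @ q'" "(l, r) \<in> R"
    using assms by (rule rstepE)
  show ?thesis using rstepI[OF *(3), of "p @ p'" "q' @ q"] unfolding *(1,2) append.assoc .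
qed

lemma sstep_context:
  assumes "(u, v) \<in> sstep R" shows "(p @ u @ q, p @ v @ q) \<in> sstep R"
  using assms rstep_context[of u v R p q] rstep_context[of v u R p q] unfolding sstep_def by blast

lemma sstep_relpow_context:
  "(u, v) \<in> sstep R ^^ k \<Longrightarrow> (p @ u @ q, p @ v @ q) \<in> sstep R ^^ k"
proof (induction k arbitrary: v)
  case (Suc k)
  then obtain w where "(u, w) \<in> sstep R ^^ k" "(w, v) \<in> sstep R" by auto
  then show ?case using Suc.IH[of w] sstep_context[of w v R p q] by (auto intro: relpow_Suc_I)
qed simp

lemma sstep_rule: "(l, r) \<in> R \<Longrightarrow> (p @ l @ q, p @ r @ q) \<in> sstep R"
  using rstepI[of l r R p q] by (simp add: sstep_def)

lemma sstep_lists: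
  assumes "R \<subseteq> lists A \<times> lists A" "(u, v) \<in> sstep R" "u \<in> lists A" shows "v \<in> lists A"
proof -
  have "l \<in> lists A \<and> r \<in> lists A" if "(l, r) \<in> R" for l r
    using subsetD[OF assms(1) that] by simp
  then show ?thesis using assms(2,3) unfolding sstep_def rstep_def by fastforce
qed

lemma sstep_relpow_lists:
  assumes "R \<subseteq> lists A \<times> lists A" "(u, v) \<in> sstep R ^^ k" "u \<in> lists A" shows "v \<in> lists A"
  using assms(2)
proof (induction k arbitrary: v)
  case (Suc k)
  then obtain w where "(u, w) \<in> sstep R ^^ k" "(w, v) \<in> sstep R" by auto
  then show ?case using Suc.IH sstep_lists[OF assms(1)] by blast
qed (use assms in simp)

lemma rule_length_bound:
  assumes "finite R"
  obtains C where "\<And>l r. (l, r) \<in> R \<Longrightarrow> length l \<le> C \<and> length r \<le> C"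
proof
  fix l r assume lr: "(l, r) \<in> R"
  have "length l + length r \<le> (\<Sum>(l, r)\<in>R. length l + length r)"
    using member_le_sum[OF lr, of "\<lambda>(l, r). length l + length r"] assms by simp
  then show "length l \<le> (\<Sum>(l, r)\<in>R. length l + length r) \<and>
    length r \<le> (\<Sum>(l, r)\<in>R. length l + length r)" by linarith
qed

text \<open>One application lengthens a word by at most \<open>C\<close>. With a bound on the number
  of steps this confines the words of a derivation to a finite set.\<close>

lemma sstep_relpow_length:
  assumes C: "\<And>l r. (l, r) \<in> R \<Longrightarrow> length l \<le> C \<and> length r \<le> C"
    and "(u, v) \<in> sstep R ^^ k"
  shows "length v \<le> length u + C * k"
  using assms(2)
proof (induction k arbitrary: v)
  case (Suc k)
  then obtain w where w: "(u, w) \<in> sstep R ^^ k" "(w, v) \<in> sstep R" by auto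
  have "length v \<le> length w + C"
  proof -
    have "length b \<le> length a + C \<and> length a \<le> length b + C" if "(a, b) \<in> rstep R" for a b
      using that C unfolding rstep_def by fastforce
    then show ?thesis using w(2) unfolding sstep_def by auto
  qed
  then show ?case using Suc.IH[OF w(1)] by simp
qed simp

section \<open>Monoids with enumerated generators, and their moves\<close>

text \<open>Words are lists of generator indices, so they can be coded by numbers whatever the type
  of the elements; \<open>g\<close> may repeat elements.\<close>

locale marked_monoid = monoid M for M :: "('a, 'b) monoid_scheme" (structure) +
  fixes n :: nat and g :: "nat \<Rightarrow> 'a"
  assumes g_closed: "i < n \<Longrightarrow> g i \<in> carrier M"
    and g_generates: "x \<in> carrier M \<Longrightarrow> \<exists>w\<in>lists {..<n}. mprod M (map g w) = x"
begin

abbreviation words :: "nat list set" where "words \<equiv> lists {..<n}"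

definition val :: "nat list \<Rightarrow> 'a" where "val w = mprod M (map g w)"

lemma val_Nil [simp]: "val [] = \<one>"
  by (simp add: val_def mprod_def)

lemma val_Cons [simp]: "val (i # w) = g i \<otimes> val w"
  by (simp add: val_def mprod_def)

lemma val_closed [simp]: "w \<in> words \<Longrightarrow> val w \<in> carrier M"
  by (induction w) (auto simp: g_closed)

lemma val_append [simp]: "u \<in> words \<Longrightarrow> v \<in> words \<Longrightarrow> val (u @ v) = val u \<otimes> val v"
  by (induction u) (auto simp: g_closed m_assoc)

lemma val_surj: "x \<in> carrier M \<Longrightarrow> \<exists>w\<in>words. val w = x"
  using g_generates by (simp add: val_def)

text \<open>Unlike an application of a defining relation, a move replaces subpaths of the right Cayley
  graph: only the values at the end of the prefixes have to agree. This makes the notion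
  invariant under quasi-isometries.\<close>

definition move :: "nat \<Rightarrow> (nat list \<times> nat list) set" where
  "move K = {(p @ l @ q, p @ r @ q) | p l r q. p \<in> words \<and> l \<in> words \<and> r \<in> words \<and> q \<in> words \<and>
     length l \<le> K \<and> length r \<le> K \<and> val (p @ l) = val (p @ r)}"

lemma moveI:
  "\<lbrakk>p \<in> words; l \<in> words; r \<in> words; q \<in> words; length l \<le> K; length r \<le> K;
    val (p @ l) = val (p @ r)\<rbrakk> \<Longrightarrow> (p @ l @ q, p @ r @ q) \<in> move K"
  unfolding move_def by blast

lemma moveE:
  assumes "(u, v) \<in> move K"
  obtains p l r q where "u = p @ l @ q" "v = p @ r @ q" "p \<in> words" "l \<in> words"
    "r \<in> words" "q \<in> words" "length l \<le> K" "length r \<le> K" "val (p @ l) = val (p @ r)"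
  using assms unfolding move_def by blast

lemma sym_move: "sym (move K)"
proof (rule symI)
  fix u v assume "(u, v) \<in> move K"
  then obtain p l r q where "u = p @ l @ q" "v = p @ r @ q" "p \<in> words" "l \<in> words"
    "r \<in> words" "q \<in> words" "length l \<le> K" "length r \<le> K" "val (p @ l) = val (p @ r)"
    by (rule moveE)
  then show "(v, u) \<in> move K" using moveI[of p r l q K] by metis
qed

lemma move_relpow_append:
  assumes "(u, v) \<in> move K ^^ k" "q \<in> words" shows "(u @ q, v @ q) \<in> move K ^^ k"
  using assms(1)
proof (induction k arbitrary: v)
  case (Suc k)
  then obtain w where w: "(u, w) \<in> move K ^^ k" "(w, v) \<in> move K" by auto
  from w(2) obtain p l r q' where "w = p @ l @ q'" "v = p @ r @ q'" "p \<in> words" "l \<in> words"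
    "r \<in> words" "q' \<in> words" "length l \<le> K" "length r \<le> K" "val (p @ l) = val (p @ r)"
    by (rule moveE)
  then have "(w @ q, v @ q) \<in> move K"
    using moveI[of p l r "q' @ q" K] assms(2) by simp
  then show ?case using Suc.IH[OF w(1)] by (metis relpow_Suc_I)
qed simp

text \<open>A relation that holds in the monoid also holds after any prefix \<open>p\<close>, so
  each application is a single move.\<close>

lemma sstep_relpow_imp_move:
  assumes R: "R \<subseteq> words \<times> words" "\<And>l r. (l, r) \<in> R \<Longrightarrow> length l \<le> K \<and> length r \<le> K"
    and sound: "\<And>l r. (l, r) \<in> R \<Longrightarrow> val l = val r"
    and "(u, v) \<in> sstep R ^^ k" "u \<in> words"
  shows "(u, v) \<in> move K ^^ k"
  using assms(4)
proof (induction k arbitrary: v)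
  case (Suc k)
  then obtain w where w: "(u, w) \<in> sstep R ^^ k" "(w, v) \<in> sstep R" by auto
  have ww: "w \<in> words" using sstep_relpow_lists[OF R(1) w(1) assms(5)] .
  have r: "(a, b) \<in> move K" if ab: "(a, b) \<in> rstep R" "a \<in> words \<or> b \<in> words" for a b
  proof -
    obtain p l r q where *: "a = p @ l @ q" "b = p @ r @ q" "(l, r) \<in> R"
      using ab(1) by (rule rstepE)
    have "p \<in> words" "q \<in> words" using ab(2) unfolding *(1,2) by auto
    moreover have "l \<in> words" "r \<in> words" using subsetD[OF R(1) *(3)] by simp_all
    ultimately show ?thesis unfolding *(1,2) using R(2)[OF *(3)] sound[OF *(3)] by (intro moveI) simp_all
  qed
  \<comment> \<open>The idle step allowed by \<open>sstep\<close> is the move that replaces the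
    empty word by itself.\<close>
  have "(w, w) \<in> move K" using moveI[of "[]" "[]" "[]" w K] ww by simp
  then have "(w, v) \<in> move K"
    using w(2) r[of w v, OF _ disjI1[OF ww]] symD[OF sym_move r[of v w, OF _ disjI2[OF ww]]]
    unfolding sstep_def by blast
  then show ?case using Suc.IH[OF w(1)] by (metis relpow_Suc_I)
qed simp

definition presents :: "(nat list \<times> nat list) set \<Rightarrow> bool" where
  "presents R \<longleftrightarrow> finite R \<and> R \<subseteq> words \<times> words \<and>
     (\<forall>u\<in>words. \<forall>v\<in>words. val u = val v \<longleftrightarrow> (u, v) \<in> cong_gen R)"

lemma sound_sstep_relpow:
  assumes R: "R \<subseteq> words \<times> words" and sound: "\<And>l r. (l, r) \<in> R \<Longrightarrow> val l = val r"
    and "(u, v) \<in> sstep R ^^ k" "u \<in> words"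
  shows "val u = val v"
  using assms(3)
proof (induction k arbitrary: v)
  case (Suc k)
  then obtain w where w: "(u, w) \<in> sstep R ^^ k" "(w, v) \<in> sstep R" by auto
  have ww: "w \<in> words" using sstep_relpow_lists[OF R w(1) assms(4)] .
  have r: "val a = val b" if ab: "(a, b) \<in> rstep R" "a \<in> words \<or> b \<in> words" for a b
  proof -
    obtain p l r q where *: "a = p @ l @ q" "b = p @ r @ q" "(l, r) \<in> R"
      using ab(1) by (rule rstepE)
    have "p \<in> words" "q \<in> words" using ab(2) unfolding *(1,2) by auto
    moreover have "l \<in> words" "r \<in> words" using subsetD[OF R *(3)] by simp_all
    ultimately show ?thesis unfolding *(1,2) using sound[OF *(3)] by simp
  qed
  have "val w = val v" using w(2) r[of w v, OF _ disjI1[OF ww]] r[of v w, OF _ disjI2[OF ww], symmetric]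
    unfolding sstep_def by blast
  then show ?case using Suc.IH[OF w(1)] by simp
qed simp

section \<open>Finitely many L-classes turn moves into finitely many relations\<close>

text \<open>The L-class of \<open>x\<close> is recorded by the principal left ideal generated by
  \<open>x\<close>, and there are finitely many of these. Mutual membership in these ideals yields
  the left multipliers \<open>s\<close> and \<open>t\<close>; the last property expresses that L is
  a right congruence.\<close>

lemma ex_L_class_representatives:
  assumes "finite (left_ideals M)"
  obtains rep where "finite (rep ` carrier M)"
    "\<And>x. x \<in> carrier M \<Longrightarrow> rep x \<in> words"
    "\<And>x. x \<in> carrier M \<Longrightarrow> \<exists>s\<in>words. val (s @ rep x) = x"
    "\<And>x. x \<in> carrier M \<Longrightarrow> \<exists>t\<in>words. val t \<otimes> x = val (rep x)"
    "\<And>x b. x \<in> carrier M \<Longrightarrow> b < n \<Longrightarrow> rep (val (rep x @ [b])) = rep (x \<otimes> g b)"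
proof -
  define L where "L x = (\<lambda>m. m \<otimes> x) ` carrier M" for x
  define rep where "rep x = (SOME w. w \<in> words \<and> L (val w) = L x)" for x
  have rep: "rep x \<in> words \<and> L (val (rep x)) = L x" if "x \<in> carrier M" for x
    unfolding rep_def by (rule someI_ex) (use val_surj[OF that] in blast)
  have self: "x \<in> L x" if "x \<in> carrier M" for x
    unfolding L_def using that by (intro image_eqI[of _ _ \<one>]) auto
  \<comment> \<open>The choice in \<open>rep\<close> sees \<open>x\<close> only through its ideal,
    so L-related elements get literally the same representative.\<close>
  have cong: "rep x = rep y" if "L x = L y" for x y
    unfolding rep_def using that by simp
  have Lmult: "L (x \<otimes> y) = (\<lambda>m. m \<otimes> y) ` L x" if "x \<in> carrier M" "y \<in> carrier M" for x y
    unfolding L_def image_image by (rule image_cong) (use that in \<open>auto simp: m_assoc\<close>)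
  have "L ` carrier M \<subseteq> left_ideals M"
  proof
    fix I assume "I \<in> L ` carrier M"
    then obtain x where x: "x \<in> carrier M" "I = L x" by blast
    have "m \<otimes> y \<in> L x" if m: "m \<in> carrier M" and y: "y \<in> L x" for m y
    proof -
      obtain z where z: "z \<in> carrier M" "y = z \<otimes> x" using y unfolding L_def by blast
      then show ?thesis unfolding L_def using m x
        by (intro image_eqI[of _ _ "m \<otimes> z"]) (auto simp: m_assoc)
    qed
    then show "I \<in> left_ideals M"
      unfolding left_ideals_def using x self[OF x(1)] by (auto simp: L_def)
  qed
  then have fin: "finite (L ` carrier M)" using assms finite_subset by blast
  show thesis
  proof
    have "rep ` carrier M = (\<lambda>I. SOME w. w \<in> words \<and> L (val w) = I) ` L ` carrier M"
      by (simp add: rep_def image_image)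
    then show "finite (rep ` carrier M)" using fin by simp
  next
    fix x assume x: "x \<in> carrier M"
    note r = rep[OF x]
    show "rep x \<in> words" using r by simp
    have "x \<in> L (val (rep x))" using r self[OF x] by simp
    then obtain m where m: "m \<in> carrier M" "x = m \<otimes> val (rep x)" unfolding L_def by blast
    obtain s where s: "s \<in> words" "val s = m" using val_surj[OF m(1)] by blast
    show "\<exists>s\<in>words. val (s @ rep x) = x" using s m r by (intro bexI[of _ s]) auto
    have "val (rep x) \<in> L x" using r self[of "val (rep x)"] by simp
    then obtain m' where m': "m' \<in> carrier M" "val (rep x) = m' \<otimes> x" unfolding L_def by blast
    then show "\<exists>t\<in>words. val t \<otimes> x = val (rep x)" using val_surj[OF m'(1)] by metis
    fix b assume b: "b < n"
    show "rep (val (rep x @ [b])) = rep (x \<otimes> g b)"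
      by (rule cong) (use r x b in \<open>simp add: g_closed Lmult\<close>)
  qed
qed

lemma finite_words_length_le: "finite {w \<in> words. length w \<le> K}"
  using finite_lists_length_le[of "{..<n}" K] by (simp add: in_lists_conv_set subset_iff lists_eq_set)

lemma move_length: "(u, v) \<in> move K \<Longrightarrow> length v \<le> length u + K"
  unfolding move_def by auto

text \<open>If \<open>p = s rep(p)\<close> and \<open>rep(p) = t p\<close>, then \<open>p l = p r\<close> implies \<open>rep(p) l = rep(p) r\<close>, so that a
  move becomes an application of one of finitely many relations.\<close>

lemma moves_by_finite_relations:
  assumes "finite (left_ideals M)"
  obtains R where "finite R" "R \<subseteq> words \<times> words" "\<And>l r. (l, r) \<in> R \<Longrightarrow> val l = val r"
    "\<And>u v. (u, v) \<in> move K \<Longrightarrow> (u, v) \<in> sstep R ^^ (2 * length u + 3)"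
proof -
  obtain rep where fin: "finite (rep ` carrier M)"
    and rep_words: "\<And>x. x \<in> carrier M \<Longrightarrow> rep x \<in> words"
    and ex_s: "\<And>x. x \<in> carrier M \<Longrightarrow> \<exists>s\<in>words. val (s @ rep x) = x"
    and ex_t: "\<And>x. x \<in> carrier M \<Longrightarrow> \<exists>t\<in>words. val t \<otimes> x = val (rep x)"
    and rep_step: "\<And>x b. x \<in> carrier M \<Longrightarrow> b < n \<Longrightarrow> rep (val (rep x @ [b])) = rep (x \<otimes> g b)"
    by (rule ex_L_class_representatives[OF assms]) blast
  \<comment> \<open>\<open>s x\<close> is a fixed left multiplier that recovers \<open>x\<close>
    from its representative.\<close>
  define s where "s x = (SOME s. s \<in> words \<and> val (s @ rep x) = x)" for x
  have s: "s x \<in> words \<and> val (s x @ rep x) = x" if "x \<in> carrier M" for x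
    unfolding s_def by (rule someI_ex) (use ex_s[OF that] in blast)
  define W where "W = rep ` carrier M"
  have W: "finite W" "W \<subseteq> words" using fin rep_words by (auto simp: W_def)
  \<comment> \<open>\<open>R1\<close> updates the representative when a letter is appended;
    \<open>R2\<close> performs a move directly after a representative.\<close>
  define R1 where "R1 = (\<lambda>(w, b). (w @ [b], s (val (w @ [b])) @ rep (val (w @ [b])))) ` (W \<times> {..<n})"
  define S where "S = {w \<in> words. length w \<le> K}"
  define R2 where "R2 = (\<lambda>(w, l, r). (w @ l, w @ r)) `
    {(w, l, r) \<in> W \<times> S \<times> S. val (w @ l) = val (w @ r)}"
  \<comment> \<open>The extra relation creates the representative of the identity out of the empty
    word, which starts the rewriting of prefixes.\<close>
  define R where "R = {([], s \<one> @ rep \<one>)} \<union> R1 \<union> R2"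
  have "finite S" unfolding S_def by (rule finite_words_length_le)
  then have "finite (W \<times> S \<times> S)" using W(1) by simp
  then have "finite {(w, l, r) \<in> W \<times> S \<times> S. val (w @ l) = val (w @ r)}"
    by (rule finite_subset[rotated]) auto
  then have "finite R2" unfolding R2_def by (rule finite_imageI)
  then have finR: "finite R" unfolding R_def R1_def using W(1) by auto
  have R1: "l \<in> words \<and> r \<in> words \<and> val l = val r" if lr: "(l, r) \<in> R1" for l r
  proof -
    obtain w b where *: "w \<in> W" "b < n" "l = w @ [b]" "r = s (val l) @ rep (val l)"
      using lr unfolding R1_def by auto
    then have l: "l \<in> words" using W by auto
    then show ?thesis using s[OF val_closed[OF l]] rep_words[OF val_closed[OF l]] *(4)
      by (simp del: val_append)
  qed
  have R2: "l \<in> words \<and> r \<in> words \<and> val l = val r" if lr: "(l, r) \<in> R2" for l r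
  proof -
    obtain w l' r' where *: "w \<in> W" "l' \<in> words" "r' \<in> words"
      "l = w @ l'" "r = w @ r'" "val (w @ l') = val (w @ r')"
      using lr unfolding R2_def S_def by (auto simp del: in_lists_conv_set val_append)
    then have "w \<in> words" using W(2) by blast
    then show ?thesis using * by (simp del: val_append)
  qed
  have R_sound: "l \<in> words \<and> r \<in> words \<and> val l = val r" if lr: "(l, r) \<in> R" for l r
  proof -
    have "(l, r) = ([], s \<one> @ rep \<one>) \<or> (l, r) \<in> R1 \<or> (l, r) \<in> R2" using lr by (simp add: R_def)
    then show ?thesis
      using R1[of l r] R2[of l r] s[OF one_closed] rep_words[OF one_closed] by (elim disjE) simp_all
  qed
  \<comment> \<open>Reading \<open>p\<close> letter by letter moves a representative along the word.
    The multipliers pile up on its left as \<sigma> and are not touched again; one step serves to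
    start and one for each letter.\<close>
  have normal: "\<exists>\<sigma>\<in>words. (p, \<sigma> @ rep (val p)) \<in> sstep R ^^ (length p + 1)" if "p \<in> words" for p
    using that
  proof (induction p rule: rev_induct)
    case Nil
    have "([], s \<one> @ rep \<one>) \<in> sstep R"
      using sstep_rule[of "[]" "s \<one> @ rep \<one>" R "[]" "[]"] by (simp add: R_def)
    then show ?case using s[of \<one>] by auto
  next
    case (snoc b p)
    then have p: "p \<in> words" and b: "b < n" by auto
    from snoc.IH[OF p] obtain \<sigma> where \<sigma>: "\<sigma> \<in> words"
      "(p, \<sigma> @ rep (val p)) \<in> sstep R ^^ (length p + 1)" by blast
    let ?w = "rep (val p) @ [b]"
    have 1: "(p @ [b], \<sigma> @ ?w) \<in> sstep R ^^ (length p + 1)"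
      using sstep_relpow_context[OF \<sigma>(2), of "[]" "[b]"] by simp
    have "(?w, s (val ?w) @ rep (val ?w)) \<in> R1" unfolding R1_def W_def
      using p b by (intro image_eqI[of _ _ "(rep (val p), b)"]) auto
    then have "(\<sigma> @ ?w, \<sigma> @ s (val ?w) @ rep (val ?w)) \<in> sstep R"
      using sstep_rule[of ?w "s (val ?w) @ rep (val ?w)" R \<sigma> "[]"] by (simp add: R_def)
    \<comment> \<open>By the right congruence, the updated representative is that of the extended
      prefix.\<close>
    moreover have "rep (val ?w) = rep (val (p @ [b]))"
      using rep_step[of "val p" b] p b by (simp add: g_closed)
    ultimately have "(\<sigma> @ ?w, (\<sigma> @ s (val ?w)) @ rep (val (p @ [b]))) \<in> sstep R" by simp
    with 1 have "(p @ [b], (\<sigma> @ s (val ?w)) @ rep (val (p @ [b]))) \<in> sstep R ^^ (length (p @ [b]) + 1)"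
      using relpow_Suc_I by fastforce
    moreover have "?w \<in> words" using rep_words[OF val_closed[OF p]] b by simp
    then have "\<sigma> @ s (val ?w) \<in> words" using \<sigma>(1) s[OF val_closed, of ?w] by simp
    ultimately show ?case by blast
  qed
  have move: "(u, v) \<in> sstep R ^^ (2 * length u + 3)" if uv: "(u, v) \<in> move K" for u v
  proof -
    from uv obtain p l r q where *: "u = p @ l @ q" "v = p @ r @ q" "p \<in> words" "l \<in> words"
      "r \<in> words" "q \<in> words" "length l \<le> K" "length r \<le> K" "val (p @ l) = val (p @ r)"
      by (rule moveE)
    from normal[OF *(3)] obtain \<sigma> where \<sigma>: "\<sigma> \<in> words"
      "(p, \<sigma> @ rep (val p)) \<in> sstep R ^^ (length p + 1)" by blast
    obtain t where t: "t \<in> words" "val t \<otimes> val p = val (rep (val p))" using ex_t[OF val_closed[OF *(3)]] by blast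
    \<comment> \<open>Multiplying \<open>p l = p r\<close> by \<open>t\<close> on the left moves the
      equation to the representative.\<close>
    have "val (rep (val p) @ l) = val (rep (val p) @ r)"
      using * t(1) rep_words[of "val p"] by (simp add: t(2)[symmetric] m_assoc)
    then have "(rep (val p) @ l, rep (val p) @ r) \<in> R2"
      unfolding R2_def W_def S_def using * by (intro image_eqI[of _ _ "(rep (val p), l, r)"]) auto
    then have 2: "(\<sigma> @ rep (val p) @ l @ q, \<sigma> @ rep (val p) @ r @ q) \<in> sstep R ^^ 1"
      using sstep_rule[of "rep (val p) @ l" "rep (val p) @ r" R \<sigma> q] by (simp add: R_def)
    have 1: "(u, \<sigma> @ rep (val p) @ l @ q) \<in> sstep R ^^ (length p + 1)"
      using sstep_relpow_context[OF \<sigma>(2), of "[]" "l @ q"] * by simp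
    \<comment> \<open>The prefix is restored by running its normalisation backwards with the same
      \<sigma>.\<close>
    have 3: "(\<sigma> @ rep (val p) @ r @ q, v) \<in> sstep R ^^ (length p + 1)"
      using sym_relpow[OF sym_sstep sstep_relpow_context[OF \<sigma>(2), of "[]" "r @ q"]] * by simp
    show ?thesis
      by (rule sstep_relpow_mono[OF _ relpow_trans[OF 1 relpow_trans[OF 2 3]]]) (simp add: *)
  qed
  show thesis
  proof (rule that[OF finR _ _ move])
    show "R \<subseteq> words \<times> words" by (rule subrelI) (simp add: R_sound del: in_lists_conv_set)
    show "val l = val r" if "(l, r) \<in> R" for l r using R_sound[OF that] by blast
  qed
qed

text \<open>Each move adds at most \<open>K\<close> letters, so all words on the way have length at
  most \<open>length u + K * k\<close>. This bounds the cost of every single move uniformly.\<close>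

lemma relpow_move_imp_sstep:
  assumes one: "\<And>u v. (u, v) \<in> move K \<Longrightarrow> (u, v) \<in> sstep R ^^ (2 * length u + 3)"
    and "(u, v) \<in> move K ^^ k"
  shows "(u, v) \<in> sstep R ^^ (k * (2 * (length u + K * k) + 3))"
proof -
  have "(u, v) \<in> sstep R ^^ (i * (2 * (length u + K * k) + 3)) \<and> length v \<le> length u + K * i"
    if "(u, v) \<in> move K ^^ i" "i \<le> k" for i
    using that
  proof (induction i arbitrary: v)
    case (Suc i)
    then obtain w where w: "(u, w) \<in> move K ^^ i" "(w, v) \<in> move K" by auto
    with Suc have IH: "(u, w) \<in> sstep R ^^ (i * (2 * (length u + K * k) + 3))"
      "length w \<le> length u + K * i" by auto
    have "K * i \<le> K * k" using Suc.prems by simp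
    with IH(2) have "length w \<le> length u + K * k" by linarith
    then have "(w, v) \<in> sstep R ^^ (2 * (length u + K * k) + 3)"
      by (intro sstep_relpow_mono[OF _ one[OF w(2)]]) simp
    from relpow_trans[OF IH(1) this] show ?case using move_length[OF w(2)] IH(2)
      by (simp add: add.commute)
  qed simp
  then show ?thesis using assms(2) by blast
qed

end

section \<open>The word problem and derivation length\<close>

definition code_drop :: "nat \<Rightarrow> nat \<Rightarrow> nat" where
  "code_drop c i = rec_nat c (\<lambda>m y. snd (prod_decode (y - 1))) i"

definition code_nth :: "nat \<Rightarrow> nat \<Rightarrow> nat" where
  "code_nth c i = fst (prod_decode (code_drop c i - 1))"

lemma code_drop_list_encode: "code_drop (list_encode w) i = list_encode (drop i w)"
proof (induction i)
  case (Suc i)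
  \<comment> \<open>The empty list has code 0, and 0 - 1 is again 0 here. Decoding it gives the tail
    0, so dropping past the end agrees with \<open>drop\<close>.\<close>
  have "prod_decode 0 = (0, 0)"
    using prod_encode_inverse[of "(0, 0)"] by (simp add: prod_encode_def)
  then have "snd (prod_decode (list_encode v - 1)) = list_encode (tl v)" for v
    by (cases v) auto
  then show ?case using Suc by (simp add: code_drop_def drop_Suc tl_drop)
qed (simp add: code_drop_def)

lemma code_nth_list_encode: "i < length w \<Longrightarrow> code_nth (list_encode w) i = w ! i"
  by (simp add: code_nth_def code_drop_list_encode Cons_nth_drop_Suc[symmetric])

lemma code_nth: "i < length (list_decode c) \<Longrightarrow> code_nth c i = list_decode c ! i"
  using code_nth_list_encode[of i "list_decode c"] by simp

lemma computable_code_drop [computable_intros]: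
  assumes "computable k a" "computable k b" shows "computable k (\<lambda>xs. code_drop (a xs) (b xs))"
  by (rule computable_compose2[OF _ assms]) (unfold code_drop_def, intro computable_intros; simp)

lemma computable_code_nth [computable_intros]:
  assumes "computable k a" "computable k b" shows "computable k (\<lambda>xs. code_nth (a xs) (b xs))"
  unfolding code_nth_def by (intro computable_intros assms)

text \<open>Only the empty list has code 0, so the length is the least number of entries whose
  removal leaves 0.\<close>

lemma computable_length_list_decode [computable_intros]:
  assumes "computable k a" shows "computable k (\<lambda>xs. length (list_decode (a xs)))"
proof (rule computable_compose1[OF _ assms])
  have drop: "code_drop c i = 0 \<longleftrightarrow> length (list_decode c) \<le> i" for c i
    using code_drop_list_encode[of "list_decode c" i] list_encode_eq[of "drop i (list_decode c)" "[]"]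
    by simp
  have "computable 1 (\<lambda>xs. LEAST i. code_drop (xs ! 0) i = 0)"
    by (intro computable_intros) (auto simp: drop)
  moreover have "(LEAST i. code_drop c i = 0) = length (list_decode c)" for c
    by (rule Least_equality) (auto simp: drop)
  ultimately show "computable 1 (\<lambda>xs. length (list_decode (xs ! 0)))" by simp
qed

text \<open>Applicability of one rule becomes a formula with bounded quantifiers over the position
  \<open>i\<close> and the letters. The letters are given by functions that agree with the words
  only inside their range, because \<open>code_nth\<close> is controlled only there.\<close>

lemma rstep_single_iff:
  assumes X: "\<And>j. j < length x \<Longrightarrow> X j = x ! j" and Y: "\<And>j. j < length y \<Longrightarrow> Y j = y ! j"
    and L: "\<And>j. j < length l \<Longrightarrow> L j = l ! j" and R: "\<And>j. j < length r \<Longrightarrow> R j = r ! j"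
  shows "(x, y) \<in> rstep {(l, r)} \<longleftrightarrow> (\<exists>i<Suc (length x). i + length l \<le> length x \<and>
     length y + length l = length x + length r \<and> (\<forall>j<i. X j = Y j) \<and>
     (\<forall>j<length l. X (i + j) = L j) \<and> (\<forall>j<length r. Y (i + j) = R j) \<and>
     (\<forall>j<length x - (i + length l). X (i + length l + j) = Y (i + length r + j)))"
    (is "_ \<longleftrightarrow> (\<exists>i<Suc (length x). ?P i)")
proof
  assume "(x, y) \<in> rstep {(l, r)}"
  then obtain p q where *: "x = p @ l @ q" "y = p @ r @ q" unfolding rstep_def by blast
  have "X j = Y j" if "j < length p" for j using X[of j] Y[of j] that * by (simp add: nth_append)
  moreover have "X (length p + j) = L j" if "j < length l" for j
    using X[of "length p + j"] L[of j] that * by (simp add: nth_append)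
  moreover have "Y (length p + j) = R j" if "j < length r" for j
    using Y[of "length p + j"] R[of j] that * by (simp add: nth_append)
  moreover have "X (length p + length l + j) = Y (length p + length r + j)" if "j < length q" for j
    using X[of "length p + length l + j"] Y[of "length p + length r + j"] that *
    by (simp add: nth_append)
  ultimately have "?P (length p)" using * by auto
  then show "\<exists>i<Suc (length x). ?P i" using * by (intro exI[of _ "length p"]) auto
next
  assume "\<exists>i<Suc (length x). ?P i"
  then obtain i where i: "?P i" by blast
  let ?p = "take i x" and ?q = "drop (i + length l) x"
  have x: "x = ?p @ l @ ?q"
  proof (rule nth_equalityI)
    fix j assume j: "j < length x"
    have "x ! j = l ! (j - i)" if "i \<le> j" "j < i + length l"
    proof -
      have "j - i < length l" using that by linarith
      then have "X (i + (j - i)) = L (j - i)" using i by blast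
      then show ?thesis using X[OF j] L[of "j - i"] that by auto
    qed
    then show "x ! j = (?p @ l @ ?q) ! j" using i j by (auto simp: nth_append)
  qed (use i in auto)
  have y: "y = ?p @ r @ ?q"
  proof (rule nth_equalityI)
    show len: "length y = length (?p @ r @ ?q)" using i by auto
    fix j assume j: "j < length y"
    \<comment> \<open>The three ranges are the common prefix, the right-hand side of the rule and
      the common suffix.\<close>
    consider "j < i" | "i \<le> j" "j < i + length r" | "i + length r \<le> j" by linarith
    then show "y ! j = (?p @ r @ ?q) ! j"
    proof cases
      case 1
      then have "X j = Y j" using i by blast
      then show ?thesis using 1 X[of j] Y[OF j] i by (auto simp: nth_append)
    next
      case 2
      have "j - i < length r" using 2 by linarith
      then have "Y (i + (j - i)) = R (j - i)" using i by blast
      then show ?thesis using Y[OF j] R[of "j - i"] 2 i by (auto simp: nth_append)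
    next
      case 3
      let ?j = "j - (i + length r)"
      have lt: "?j < length x - (i + length l)" using i j 3 by auto
      then have "X (i + length l + ?j) = Y (i + length r + ?j)" using i by blast
      then have "X (i + length l + ?j) = Y j" using 3 by simp
      then have "y ! j = x ! (i + length l + ?j)" using X[of "i + length l + ?j"] Y[OF j] lt by simp
      then show ?thesis using 3 i lt by (auto simp: nth_append)
    qed
  qed
  show "(x, y) \<in> rstep {(l, r)}" unfolding rstep_def using x y by blast
qed

lemma rstep_insert: "rstep (insert lr R) = rstep {lr} \<union> rstep R"
  unfolding rstep_def by blast

text \<open>The relations are treated one at a time. For a fixed relation, \<open>l\<close> and
  \<open>r\<close> are constants, and the matching formula is built from computable parts.\<close>

lemma computable_pred_rstep:
  assumes "finite R" "computable k a" "computable k b"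
  shows "computable_pred k (\<lambda>xs. (list_decode (a xs), list_decode (b xs)) \<in> rstep R)"
  using assms(1)
proof (induction R)
  case empty
  show ?case by (simp add: rstep_def computable_pred_const)
next
  case (insert lr R)
  obtain l r where lr: "lr = (l, r)" by force
  let ?P = "\<lambda>c d. \<exists>i<Suc (length (list_decode c)). i + length l \<le> length (list_decode c) \<and>
     length (list_decode d) + length l = length (list_decode c) + length r \<and>
     (\<forall>j<i. code_nth c j = code_nth d j) \<and>
     (\<forall>j<length l. code_nth c (i + j) = code_nth (list_encode l) j) \<and>
     (\<forall>j<length r. code_nth d (i + j) = code_nth (list_encode r) j) \<and>
     (\<forall>j<length (list_decode c) - (i + length l).
        code_nth c (i + length l + j) = code_nth d (i + length r + j))"
  have iff: "(list_decode c, list_decode d) \<in> rstep {(l, r)} \<longleftrightarrow> ?P c d" for c d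
    by (rule rstep_single_iff) (auto simp: code_nth)
  have "computable_pred 2 (\<lambda>xs. ?P (xs ! 0) (xs ! 1))"
    by (intro computable_intros) simp_all
  from computable_pred_compose2[OF this assms(2,3)]
  have "computable_pred k (\<lambda>xs. (list_decode (a xs), list_decode (b xs)) \<in> rstep {(l, r)})"
    unfolding iff .
  from computable_pred_disj[OF this insert.IH] show ?case
    by (simp add: lr rstep_insert[of "(l, r)" R])
qed

lemma computable_pred_sstep:
  assumes "finite R" "computable k a" "computable k b"
  shows "computable_pred k (\<lambda>xs. (list_decode (a xs), list_decode (b xs)) \<in> sstep R)"
proof -
  have "computable_pred k (\<lambda>xs. a xs = b xs \<or> (list_decode (a xs), list_decode (b xs)) \<in> rstep R \<or>
      (list_decode (b xs), list_decode (a xs)) \<in> rstep R)"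
    by (intro computable_intros computable_pred_rstep assms)
  then show ?thesis
    by (rule computable_pred_cong) (auto simp: sstep_def list_decode_eq)
qed

section \<open>Codes of derivations\<close>

text \<open>\<open>x\<close> codes the pair of end words and \<open>z\<close> the list of codes of
  all words of the derivation, which is one longer than the number of steps.\<close>

definition derivation_code :: "(nat list \<times> nat list) set \<Rightarrow> nat \<Rightarrow> nat \<Rightarrow> bool" where
  "derivation_code R x z \<longleftrightarrow> 0 < length (list_decode z) \<and>
     code_nth z 0 = fst (prod_decode x) \<and>
     code_nth z (length (list_decode z) - 1) = snd (prod_decode x) \<and>
     (\<forall>i<length (list_decode z) - 1.
        (list_decode (code_nth z i), list_decode (code_nth z (Suc i))) \<in> sstep R)"

lemma computable_pred_derivation_code:
  assumes "finite R" "computable k a" "computable k b"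
  shows "computable_pred k (\<lambda>xs. derivation_code R (a xs) (b xs))"
  by (rule computable_pred_compose2[OF _ assms(2,3)])
    (unfold derivation_code_def, (intro computable_intros computable_pred_sstep assms(1); simp)+)

lemma length_list_decode_le: "length (list_decode z) \<le> z"
proof -
  have "length w \<le> list_encode w" for w
  proof (induction w)
    case (Cons a w)
    then show ?case using le_prod_encode_2[of "list_encode w" a] by simp
  qed simp
  from this[of "list_decode z"] show ?thesis by simp
qed

text \<open>A list is no longer than its code, so the code itself serves as a crude bound on the
  number of steps.\<close>

lemma derivation_code_sound:
  assumes "derivation_code R (prod_encode (list_encode u, list_encode v)) z"
  shows "(u, v) \<in> sstep R ^^ z"
proof (rule sstep_relpow_mono)
  let ?k = "length (list_decode z) - 1"
  show "?k \<le> z" using length_list_decode_le[of z] by simp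
  have "list_decode (code_nth z 0) = u" "list_decode (code_nth z ?k) = v"
    using assms by (auto simp: derivation_code_def)
  then show "(u, v) \<in> sstep R ^^ ?k" unfolding relpow_fun_conv
    using assms by (intro exI[of _ "\<lambda>i. list_decode (code_nth z i)"]) (auto simp: derivation_code_def)
qed

text \<open>This is the code of the constant list of length \<open>m\<close> with entries
  \<open>b\<close>. By monotonicity of the pairing it dominates every list of at most
  \<open>m\<close> entries that are at most \<open>b\<close>.\<close>

definition code_bound :: "nat \<Rightarrow> nat \<Rightarrow> nat" where
  "code_bound b m = rec_nat 0 (\<lambda>i y. Suc (prod_encode (b, y))) m"

lemma computable_code_bound [computable_intros]:
  assumes "computable k a" "computable k b" shows "computable k (\<lambda>xs. code_bound (a xs) (b xs))"
  by (rule computable_compose2[OF _ assms]) (unfold code_bound_def, intro computable_intros; simp)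

lemma prod_encode_mono:
  assumes "a \<le> a'" "b \<le> b'" shows "prod_encode (a, b) \<le> prod_encode (a', b')"
proof -
  have "triangle i \<le> triangle j" if "i \<le> j" for i j
    using that by (induction rule: dec_induct) auto
  from this[of "a + b" "a' + b'"] show ?thesis using assms by (simp add: prod_encode_def)
qed

lemma list_encode_le_code_bound:
  "\<lbrakk>\<And>x. x \<in> set w \<Longrightarrow> x \<le> b; length w \<le> m\<rbrakk> \<Longrightarrow> list_encode w \<le> code_bound b m"
proof (induction m arbitrary: w)
  case (Suc m)
  show ?case
  proof (cases w)
    case (Cons a w')
    then have "list_encode w' \<le> code_bound b m" "a \<le> b" using Suc by auto
    then show ?thesis using Cons prod_encode_mono[of a b] by (simp add: code_bound_def)
  qed simp
qed simp

lemma derivation_code_complete: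
  assumes "(u, v) \<in> sstep R ^^ k"
    and "\<And>w i. (u, w) \<in> sstep R ^^ i \<Longrightarrow> i \<le> k \<Longrightarrow> list_encode w \<le> b"
  shows "\<exists>z\<le>code_bound b (Suc k). derivation_code R (prod_encode (list_encode u, list_encode v)) z"
proof -
  obtain f where f: "f 0 = u" "f k = v" "\<And>i. i < k \<Longrightarrow> (f i, f (Suc i)) \<in> sstep R"
    using assms(1) unfolding relpow_fun_conv by blast
  have reach: "(u, f i) \<in> sstep R ^^ i" if "i \<le> k" for i
    unfolding relpow_fun_conv using f that by (intro exI[of _ f]) auto
  let ?ws = "map (\<lambda>i. list_encode (f i)) [0..<Suc k]"
  have "list_encode ?ws \<le> code_bound b (Suc k)"
  proof (rule list_encode_le_code_bound)
    fix x assume "x \<in> set ?ws"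
    then obtain i where "i \<le> k" "x = list_encode (f i)"
      by (auto simp: less_Suc_eq_le simp del: upt_Suc)
    then show "x \<le> b" using assms(2)[OF reach] by simp
  qed simp
  moreover have "code_nth (list_encode ?ws) i = list_encode (f i)" if "i \<le> k" for i
    using that code_nth_list_encode[of i ?ws] by (simp del: upt_Suc)
  then have "derivation_code R (prod_encode (list_encode u, list_encode v)) (list_encode ?ws)"
    unfolding derivation_code_def using f by (simp del: upt_Suc)
  ultimately show ?thesis by blast
qed

section \<open>Decidability of the word problem and computable bounds on derivations\<close>

context marked_monoid
begin

lemma list_encode_words_le:
  "w \<in> words \<Longrightarrow> length w \<le> m \<Longrightarrow> list_encode w \<le> code_bound n m"
  by (rule list_encode_le_code_bound) auto

definition word_problem :: "nat set" where
  "word_problem = {prod_encode (list_encode u, list_encode v) | u v.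
     u \<in> words \<and> v \<in> words \<and> val u = val v}"

text \<open>Deciding first whether two words are equal makes the search for a derivation total. The
  codes found for the finitely many pairs of words of length at most \<open>m\<close> then give the
  bound.\<close>

lemma computable_Dehn_bound:
  assumes "presents R" "decidable_set word_problem"
  obtains D where "computable 1 (\<lambda>xs. D (xs ! 0))"
    "\<And>u v m. \<lbrakk>u \<in> words; v \<in> words; val u = val v; length u \<le> m; length v \<le> m\<rbrakk> \<Longrightarrow>
       (u, v) \<in> sstep R ^^ D m"
proof -
  have R: "finite R" using assms(1) by (simp add: presents_def)
  obtain f where f: "\<And>x. x \<in> word_problem \<Longrightarrow> reval f [x] 0" "\<And>x. x \<notin> word_problem \<Longrightarrow> reval f [x] 1"
    using assms(2) unfolding decidable_set_def by blast
  have "computable_pred 1 (\<lambda>xs. xs ! 0 \<in> word_problem)"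
    unfolding computable_pred_def computable_def using f
    by (intro exI[of _ f]) (auto simp: length_Suc_conv)
  note wp = computable_pred_compose1[where P = "\<lambda>x. x \<in> word_problem", OF this]
  \<comment> \<open>Outside the word problem the condition holds at once and the search returns 0;
    inside, it returns the least derivation code.\<close>
  define h where "h x = (LEAST z. x \<notin> word_problem \<or> derivation_code R x z)" for x
  have ex: "\<exists>z. x \<notin> word_problem \<or> derivation_code R x z" for x
  proof (cases "x \<in> word_problem")
    case True
    then obtain u v where uv: "x = prod_encode (list_encode u, list_encode v)"
      "u \<in> words" "v \<in> words" "val u = val v" unfolding word_problem_def by blast
    then have "(u, v) \<in> cong_gen R" using assms(1) unfolding presents_def by blast
    then obtain k where k: "(u, v) \<in> sstep R ^^ k" unfolding cong_gen_eq_relpow by blast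
    obtain C where C: "\<And>l r. (l, r) \<in> R \<Longrightarrow> length l \<le> C \<and> length r \<le> C"
      using rule_length_bound[OF R] by blast
    have bound: "list_encode w \<le> code_bound n (length u + C * k)"
      if "(u, w) \<in> sstep R ^^ i" "i \<le> k" for w i
    proof (rule list_encode_words_le)
      show "w \<in> words" using sstep_relpow_lists[OF _ that(1) uv(2)] assms(1)
        unfolding presents_def by blast
      show "length w \<le> length u + C * k"
        using sstep_relpow_length[OF C that(1)] mult_le_mono2[OF that(2), of C] by linarith
    qed
    have "\<exists>z\<le>code_bound (code_bound n (length u + C * k)) (Suc k). derivation_code R x z"
      unfolding uv(1) by (rule derivation_code_complete[OF k bound])
    then show ?thesis by blast
  qed simp
  have "computable 1 (\<lambda>xs. h (xs ! 0))" unfolding h_def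
    by (intro computable_intros wp computable_pred_derivation_code R ex) simp_all
  note h = computable_compose1[where f = h, OF this]
  \<comment> \<open>A sum in place of a maximum dominates each \<open>h x\<close> and is a plain
    recursion. Its range contains the codes of all pairs of words of length at most
    \<open>m\<close>.\<close>
  define D where "D m = (\<Sum>x<Suc (prod_encode (code_bound n m, code_bound n m)). h x)" for m
  have sum: "(\<Sum>x<m. h x) = rec_nat 0 (\<lambda>i y. y + h i) m" for m
    by (induction m) auto
  show thesis
  proof
    show "computable 1 (\<lambda>xs. D (xs ! 0))"
      unfolding D_def sum by (intro computable_intros h) simp_all
  next
    fix u v m
    assume uv: "u \<in> words" "v \<in> words" "val u = val v" "length u \<le> m" "length v \<le> m"
    let ?x = "prod_encode (list_encode u, list_encode v)"
    have x: "?x \<in> word_problem" unfolding word_problem_def using uv by blast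
    have "derivation_code R ?x (h ?x)" using LeastI_ex[OF ex[of ?x]] x unfolding h_def by simp
    then have *: "(u, v) \<in> sstep R ^^ h ?x" by (rule derivation_code_sound)
    have "?x < Suc (prod_encode (code_bound n m, code_bound n m))"
      using prod_encode_mono[OF list_encode_words_le[OF uv(1,4)] list_encode_words_le[OF uv(2,5)]] by simp
    then have "h ?x \<le> D m" unfolding D_def by (intro member_le_sum) auto
    then show "(u, v) \<in> sstep R ^^ D m" using * by (rule sstep_relpow_mono)
  qed
qed

text \<open>A computable bound on the number of steps bounds the words of a derivation and hence its
  code, so a bounded search decides equality.\<close>

lemma decidable_word_problem:
  assumes R: "finite R" "R \<subseteq> words \<times> words" and sound: "\<And>l r. (l, r) \<in> R \<Longrightarrow> val l = val r"
    and D: "computable 1 (\<lambda>xs. D (xs ! 0))"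
    and Dehn: "\<And>u v. \<lbrakk>u \<in> words; v \<in> words; val u = val v\<rbrakk> \<Longrightarrow>
       (u, v) \<in> sstep R ^^ D (length u + length v)"
  shows "decidable_set word_problem"
proof -
  obtain C where C: "\<And>l r. (l, r) \<in> R \<Longrightarrow> length l \<le> C \<and> length r \<le> C"
    using rule_length_bound[OF R(1)] by blast
  define len where "len x = length (list_decode (fst (prod_decode x))) +
    length (list_decode (snd (prod_decode x)))" for x
  \<comment> \<open>The inner bound is for the code of a word of the derivation, the outer one for
    the list of at most \<open>D (len x) + 1\<close> such codes.\<close>
  define F where "F x = code_bound (code_bound n (len x + C * D (len x))) (Suc (D (len x)))" for x
  define Q where "Q x \<longleftrightarrow>
     (\<forall>i<length (list_decode (fst (prod_decode x))). code_nth (fst (prod_decode x)) i < n) \<and>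
     (\<forall>i<length (list_decode (snd (prod_decode x))). code_nth (snd (prod_decode x)) i < n) \<and>
     (\<exists>z<Suc (F x). derivation_code R x z)" for x
  have words: "(\<forall>i<length (list_decode c). code_nth c i < n) \<longleftrightarrow> list_decode c \<in> words" for c
    unfolding in_lists_conv_set all_set_conv_all_nth by (auto simp: code_nth)
  have "computable_pred 1 (\<lambda>xs. Q (xs ! 0))"
    unfolding Q_def F_def len_def
    by (intro computable_intros computable_compose1[OF D] computable_pred_derivation_code R(1)) simp_all
  moreover have "Q x \<longleftrightarrow> x \<in> word_problem" for x
  proof -
    define u v where "u = list_decode (fst (prod_decode x))" and "v = list_decode (snd (prod_decode x))"
    have x: "x = prod_encode (list_encode u, list_encode v)" by (simp add: u_def v_def)
    have x_iff: "x \<in> word_problem \<longleftrightarrow> u \<in> words \<and> v \<in> words \<and> val u = val v"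
    proof
      assume "x \<in> word_problem"
      then obtain u' v' where "x = prod_encode (list_encode u', list_encode v')"
        and *: "u' \<in> words" "v' \<in> words" "val u' = val v'" unfolding word_problem_def by blast
      then have "u = u'" "v = v'" by (simp_all add: u_def v_def)
      then show "u \<in> words \<and> v \<in> words \<and> val u = val v" using * by simp
    next
      assume "u \<in> words \<and> v \<in> words \<and> val u = val v"
      then show "x \<in> word_problem" unfolding word_problem_def using x by blast
    qed
    have complete: "\<exists>z<Suc (F x). derivation_code R x z" if uv: "u \<in> words" "v \<in> words" "val u = val v"
    proof -
      have len: "len x = length u + length v" by (simp add: len_def u_def v_def)
      have bound: "list_encode w \<le> code_bound n (len x + C * D (len x))"
        if "(u, w) \<in> sstep R ^^ i" "i \<le> D (len x)" for w i
      proof (rule list_encode_words_le)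
        show "w \<in> words" using sstep_relpow_lists[OF R(2) that(1) uv(1)] .
        show "length w \<le> len x + C * D (len x)"
          using sstep_relpow_length[OF C that(1)] mult_le_mono2[OF that(2), of C] len by linarith
      qed
      have "\<exists>z\<le>F x. derivation_code R (prod_encode (list_encode u, list_encode v)) z"
        unfolding F_def by (rule derivation_code_complete[OF Dehn[OF uv, folded len] bound])
      then show ?thesis using x by (metis le_imp_less_Suc)
    qed
    \<comment> \<open>Conversely, a derivation that starts in a word stays among words and preserves
      values.\<close>
    have "val u = val v" if "derivation_code R x z" "u \<in> words" for z
    proof -
      have "derivation_code R (prod_encode (list_encode u, list_encode v)) z"
        using that(1) x by metis
      from sound_sstep_relpow[OF R(2) sound derivation_code_sound[OF this] that(2)] show ?thesis .
    qed
    then have "u \<in> words \<and> v \<in> words \<and> (\<exists>z<Suc (F x). derivation_code R x z) \<longleftrightarrow>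
        u \<in> words \<and> v \<in> words \<and> val u = val v" using complete by metis
    then show ?thesis unfolding x_iff unfolding Q_def words unfolding u_def v_def .
  qed
  ultimately have "computable_pred 1 (\<lambda>xs. xs ! 0 \<in> word_problem)" by simp
  then obtain r where "\<And>xs. length xs = 1 \<Longrightarrow> reval r xs (if xs ! 0 \<in> word_problem then 0 else 1)"
    unfolding computable_pred_def computable_def by blast
  then have "reval r [x] (if x \<in> word_problem then 0 else 1)" for x
    by (metis One_nat_def length_Cons list.size(3) nth_Cons_0)
  then show ?thesis unfolding decidable_set_def by (intro exI[of _ r]) (metis (full_types))
qed

end

section \<open>Transport along quasi-isometries\<close>

text \<open>\<open>f\<close> need not be a homomorphism. All that is asked is that each edge of the
  Cayley graph of \<open>M\<close> is sent to a chosen directed path of length at most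
  \<open>C\<close> between the images of its ends.\<close>

locale coarse_map = M: marked_monoid M m g + N: marked_monoid N n h
  for M :: "('a, 'b) monoid_scheme" and m g and N :: "('c, 'd) monoid_scheme" and n h +
  fixes f :: "'a \<Rightarrow> 'c" and \<phi> :: "'a \<Rightarrow> nat \<Rightarrow> nat list" and C :: nat
  assumes f_closed: "x \<in> carrier M \<Longrightarrow> f x \<in> carrier N"
    and edge: "\<lbrakk>x \<in> carrier M; a < m\<rbrakk> \<Longrightarrow> \<phi> x a \<in> N.words \<and> length (\<phi> x a) \<le> C \<and>
      f x \<otimes>\<^bsub>N\<^esub> N.val (\<phi> x a) = f (x \<otimes>\<^bsub>M\<^esub> g a)"
begin

text \<open>The image of a letter depends on the vertex at which it is read, so the current vertex
  is an argument of the recursion.\<close>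

primrec lift :: "'a \<Rightarrow> nat list \<Rightarrow> nat list" where
  "lift x [] = []"
| "lift x (a # w) = \<phi> x a @ lift (x \<otimes>\<^bsub>M\<^esub> g a) w"

lemma lift_words: "x \<in> carrier M \<Longrightarrow> w \<in> M.words \<Longrightarrow> lift x w \<in> N.words"
proof (induction w arbitrary: x)
  case (Cons a w)
  then have "a < m" "w \<in> M.words" by auto
  then show ?case using Cons.IH[of "x \<otimes>\<^bsub>M\<^esub> g a"] Cons.prems(1) edge[of x a] M.g_closed[of a]
    by (simp del: in_lists_conv_set)
qed simp

lemma length_lift: "x \<in> carrier M \<Longrightarrow> w \<in> M.words \<Longrightarrow> length (lift x w) \<le> C * length w"
proof (induction w arbitrary: x)
  case (Cons a w)
  then have "a < m" "w \<in> M.words" by auto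
  then show ?case using Cons.IH[of "x \<otimes>\<^bsub>M\<^esub> g a"] Cons.prems(1) edge[of x a] M.g_closed[of a]
    by (simp add: add_mono del: in_lists_conv_set)
qed simp

lemma val_lift:
  "x \<in> carrier M \<Longrightarrow> w \<in> M.words \<Longrightarrow> f x \<otimes>\<^bsub>N\<^esub> N.val (lift x w) = f (x \<otimes>\<^bsub>M\<^esub> M.val w)"
proof (induction w arbitrary: x)
  case (Cons a w)
  then have a: "a < m" "w \<in> M.words" by auto
  let ?y = "x \<otimes>\<^bsub>M\<^esub> g a"
  have y: "?y \<in> carrier M" using Cons.prems(1) M.g_closed[OF a(1)] by simp
  note e = edge[OF Cons.prems(1) a(1)]
  have "f x \<otimes>\<^bsub>N\<^esub> N.val (lift x (a # w)) = f x \<otimes>\<^bsub>N\<^esub> (N.val (\<phi> x a) \<otimes>\<^bsub>N\<^esub> N.val (lift ?y w))"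
    using e lift_words[OF y a(2)] by simp
  also have "\<dots> = f ?y \<otimes>\<^bsub>N\<^esub> N.val (lift ?y w)"
    using e lift_words[OF y a(2)] f_closed[OF Cons.prems(1)] by (simp add: N.m_assoc[symmetric])
  also have "\<dots> = f (?y \<otimes>\<^bsub>M\<^esub> M.val w)" by (rule Cons.IH[OF y a(2)])
  finally show ?case using Cons.prems(1) a M.g_closed[OF a(1)] by (simp add: M.m_assoc)
qed (simp add: f_closed)

lemma lift_append:
  "x \<in> carrier M \<Longrightarrow> u \<in> M.words \<Longrightarrow> lift x (u @ v) = lift x u @ lift (x \<otimes>\<^bsub>M\<^esub> M.val u) v"
proof (induction u arbitrary: x)
  case (Cons a u)
  then have "a < m" "u \<in> M.words" by auto
  then show ?case using Cons.IH[of "x \<otimes>\<^bsub>M\<^esub> g a"] Cons.prems(1) M.g_closed[of a]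
    by (simp add: M.m_assoc del: in_lists_conv_set)
qed simp

text \<open>Since \<open>f\<close> may move the identity, image paths are prefixed by a fixed path
  from the identity of \<open>N\<close> to the image of the identity.\<close>

definition base :: "nat list" where
  "base = (SOME w. w \<in> N.words \<and> N.val w = f \<one>\<^bsub>M\<^esub>)"

lemma base: "base \<in> N.words" "N.val base = f \<one>\<^bsub>M\<^esub>"
proof -
  have "\<exists>w. w \<in> N.words \<and> N.val w = f \<one>\<^bsub>M\<^esub>" using N.val_surj[OF f_closed[OF M.one_closed]] by blast
  from someI_ex[OF this] show "base \<in> N.words" "N.val base = f \<one>\<^bsub>M\<^esub>"
    unfolding base_def by blast+
qed

definition path :: "nat list \<Rightarrow> nat list" where
  "path w = base @ lift \<one>\<^bsub>M\<^esub> w"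

lemma path_words: "w \<in> M.words \<Longrightarrow> path w \<in> N.words"
  using base lift_words[of "\<one>\<^bsub>M\<^esub>" w] by (simp add: path_def del: in_lists_conv_set)

lemma val_path: "w \<in> M.words \<Longrightarrow> N.val (path w) = f (M.val w)"
  using base lift_words[of "\<one>\<^bsub>M\<^esub>" w] val_lift[of "\<one>\<^bsub>M\<^esub>" w]
  by (simp add: path_def del: in_lists_conv_set)

lemma path_append: "u \<in> M.words \<Longrightarrow> path (u @ v) = path u @ lift (M.val u) v"
  by (simp add: path_def lift_append del: in_lists_conv_set)

lemma length_path: "w \<in> M.words \<Longrightarrow> length (path w) \<le> length base + C * length w"
  using length_lift[of "\<one>\<^bsub>M\<^esub>" w] by (simp add: path_def del: in_lists_conv_set)

text \<open>The two sides of a move reach the same vertex, so the lifts of \<open>q\<close> coincide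
  and only the lifts of \<open>l\<close> and \<open>r\<close> differ.\<close>

lemma move_path:
  assumes "(u, v) \<in> M.move K" and K': "C * K \<le> K'"
  shows "(path u, path v) \<in> N.move K'"
  using assms(1)
proof (rule M.moveE)
  fix p l r q
  assume *: "u = p @ l @ q" "v = p @ r @ q" and w: "p \<in> M.words" "l \<in> M.words" "r \<in> M.words" "q \<in> M.words"
    and le: "length l \<le> K" "length r \<le> K" and eq: "M.val (p @ l) = M.val (p @ r)"
  let ?x = "M.val p" and ?y = "M.val (p @ l)"
  have words: "p @ l \<in> M.words" "p @ r \<in> M.words" using w by auto
  have x: "?x \<in> carrier M" "?y \<in> carrier M"
    using M.val_closed[OF w(1)] M.val_closed[OF words(1)] by blast+
  have u: "path u = path p @ lift ?x l @ lift ?y q"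
    using path_append[OF words(1), of q] path_append[OF w(1), of l] * by simp
  have v: "path v = path p @ lift ?x r @ lift ?y q"
    using path_append[OF words(2), of q] path_append[OF w(1), of r] * by (simp add: eq del: M.val_append)
  show ?thesis unfolding u v
  proof (rule N.moveI)
    show "path p \<in> N.words" by (rule path_words[OF w(1)])
    show "lift ?x l \<in> N.words" "lift ?x r \<in> N.words" "lift ?y q \<in> N.words"
      using lift_words x w by blast+
    show "length (lift ?x l) \<le> K'" "length (lift ?x r) \<le> K'"
      using length_lift[OF x(1) w(2)] length_lift[OF x(1) w(3)] mult_le_mono2[OF le(1), of C]
        mult_le_mono2[OF le(2), of C] K' by linarith+
    show "N.val (path p @ lift ?x l) = N.val (path p @ lift ?x r)"
      using val_path[OF words(1)] val_path[OF words(2)] path_append[OF w(1)] eq by metis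
  qed
qed

lemma move_relpow_path:
  assumes "C * K \<le> K'"
  shows "(u, v) \<in> M.move K ^^ k \<Longrightarrow> (path u, path v) \<in> N.move K' ^^ k"
proof (induction k arbitrary: v)
  case (Suc k)
  then obtain w where w: "(u, w) \<in> M.move K ^^ k" "(w, v) \<in> M.move K" by auto
  show ?case using relpow_Suc_I[OF Suc.IH[OF w(1)] move_path[OF w(2) assms]] .
qed simp

end

section \<open>Ladders between a path and its image under the composite\<close>

text \<open>Distances are directed, so short paths from \<open>t\<close> to \<open>f (f' t)\<close>
  and back are separate data. One constant \<open>C\<close> serves all the bounds.\<close>

locale coarse_equivalence = F: coarse_map M m g N n h f \<phi> C + G: coarse_map N n h M m g f' \<gamma> C
  for M :: "('a, 'b) monoid_scheme" and m g and N :: "('c, 'd) monoid_scheme" and n h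
    and f \<phi> C f' \<gamma> +
  fixes \<rho> \<rho>' :: "'c \<Rightarrow> nat list"
  assumes rung: "t \<in> carrier N \<Longrightarrow> \<rho> t \<in> F.N.words \<and> length (\<rho> t) \<le> C \<and> t \<otimes>\<^bsub>N\<^esub> F.N.val (\<rho> t) = f (f' t)"
    and rung': "t \<in> carrier N \<Longrightarrow> \<rho>' t \<in> F.N.words \<and> length (\<rho>' t) \<le> C \<and>
      f (f' t) \<otimes>\<^bsub>N\<^esub> F.N.val (\<rho>' t) = t"
begin

text \<open>The sum dominates each bound that occurs: images of moves, the detour along two rungs,
  the two sides of a ladder cell, and the initial cell.\<close>

definition scale :: "nat \<Rightarrow> nat" where
  "scale K = C * K + 2 * C + 1 + C * C + length F.base + C * length G.base"

lemma scale_ge: "C * K \<le> scale K" "C + C \<le> scale K" "C + 1 \<le> scale K" "C + C * C \<le> scale K"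
  "length F.base + C * length G.base \<le> scale K"
  by (auto simp: scale_def)

text \<open>Each letter contributes one bounded cell between neighbouring rungs, and one more cell
  at the identity accounts for the base paths.\<close>

lemma ladder:
  assumes "u \<in> F.N.words"
  shows "(u @ \<rho> (F.N.val u), F.path (G.path u)) \<in> F.N.move (scale K) ^^ (length u + 1)"
  using assms
proof (induction u rule: rev_induct)
  case Nil
  have b: "G.base \<in> F.M.words" "F.M.val G.base = f' \<one>\<^bsub>N\<^esub>" using G.base by auto
  have p: "G.path [] = G.base" by (simp add: G.path_def)
  have val: "F.N.val (F.path G.base) = f (f' \<one>\<^bsub>N\<^esub>)" using F.val_path[OF b(1)] b(2) by simp
  note r = rung[OF F.N.one_closed]
  have v: "F.N.val (\<rho> \<one>\<^bsub>N\<^esub>) = f (f' \<one>\<^bsub>N\<^esub>)" using r F.N.val_closed[of "\<rho> \<one>\<^bsub>N\<^esub>"]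
    by (metis F.N.l_one)
  have "([] @ \<rho> \<one>\<^bsub>N\<^esub> @ [], [] @ F.path G.base @ []) \<in> F.N.move (scale K)"
  proof (rule F.N.moveI)
    show "length (\<rho> \<one>\<^bsub>N\<^esub>) \<le> scale K" using r scale_ge(3)[of K] by linarith
    show "length (F.path G.base) \<le> scale K"
      using F.length_path[OF b(1)] scale_ge(5)[of K] by linarith
  qed (use r v val F.path_words[OF b(1)] in simp_all)
  then show ?case by (simp add: p)
next
  case (snoc b u)
  then have u: "u \<in> F.N.words" and b: "b < n" by auto
  then have ub: "u @ [b] \<in> F.N.words" by simp
  let ?t = "F.N.val u" and ?t' = "F.N.val (u @ [b])"
  have t: "?t \<in> carrier N" "?t' \<in> carrier N"
    using F.N.val_closed[OF u] F.N.val_closed[OF ub] by blast+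
  have g: "f' ?t \<in> carrier M" by (rule G.f_closed[OF t(1)])
  have t': "?t' = ?t \<otimes>\<^bsub>N\<^esub> h b" using u b by (simp add: F.N.g_closed)
  note e = G.edge[OF t(1) b]
  \<comment> \<open>\<open>?k\<close> is the image under \<open>f\<close> of the path chosen for the
    edge \<open>b\<close> by \<open>f'\<close>; it joins \<open>f (f' ?t)\<close> to
    \<open>f (f' ?t')\<close>.\<close>
  let ?k = "F.lift (f' ?t) (\<gamma> ?t b)"
  have "C * length (\<gamma> ?t b) \<le> C * C" using e by simp
  then have k: "?k \<in> F.N.words" "length ?k \<le> C * C" "f (f' ?t) \<otimes>\<^bsub>N\<^esub> F.N.val ?k = f (f' ?t')"
    using F.lift_words[OF g, of "\<gamma> ?t b"] F.length_lift[OF g, of "\<gamma> ?t b"]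
      F.val_lift[OF g, of "\<gamma> ?t b"] e t' by (auto intro: le_trans)
  have "G.path (u @ [b]) = G.path u @ \<gamma> ?t b" using G.path_append[OF u, of "[b]"] by simp
  then have p: "F.path (G.path (u @ [b])) = F.path (G.path u) @ ?k"
    using F.path_append[OF G.path_words[OF u]] G.val_path[OF u] by simp
  have 1: "((u @ \<rho> ?t) @ ?k, F.path (G.path (u @ [b]))) \<in> F.N.move (scale K) ^^ (length u + 1)"
    unfolding p by (rule F.N.move_relpow_append[OF snoc.IH[OF u] k(1)])
  note r = rung[OF t(1)] and r' = rung[OF t(2)]
  \<comment> \<open>The cell: from \<open>?t\<close>, going along \<open>b\<close> and then down the
    new rung ends where the old rung followed by \<open>?k\<close> ends. The induction hypothesis
    then absorbs the old rung.\<close>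
  have "(u @ ([b] @ \<rho> ?t') @ [], u @ (\<rho> ?t @ ?k) @ []) \<in> F.N.move (scale K)"
  proof (rule F.N.moveI)
    show "length ([b] @ \<rho> ?t') \<le> scale K" using r' scale_ge(3)[of K] by simp
    show "length (\<rho> ?t @ ?k) \<le> scale K" using r k(2) scale_ge(4)[of K] by simp
    have "F.N.val (u @ [b] @ \<rho> ?t') = f (f' ?t')"
      using F.N.val_append[OF ub, of "\<rho> ?t'"] r' by simp
    moreover have "F.N.val (u @ \<rho> ?t @ ?k) = f (f' ?t')"
      using r k t(1) u by (simp add: F.N.m_assoc[symmetric] del: in_lists_conv_set)
    ultimately show "F.N.val (u @ [b] @ \<rho> ?t') = F.N.val (u @ \<rho> ?t @ ?k)" by simp
  qed (use u b r r' k in auto)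
  then have "((u @ [b]) @ \<rho> ?t', (u @ \<rho> ?t) @ ?k) \<in> F.N.move (scale K) ^^ 1" by simp
  from relpow_trans[OF this 1] show ?case by simp
qed

text \<open>One move inserts at the end of \<open>u\<close> the loop along \<open>\<rho>\<close> and
  back along \<open>\<rho>'\<close>. The ladder then replaces \<open>u\<close> with the outgoing
  rung by the image path.\<close>

lemma ladder_closed:
  assumes u: "u \<in> F.N.words"
  shows "(u, F.path (G.path u) @ \<rho>' (F.N.val u)) \<in> F.N.move (scale K) ^^ (length u + 2)"
proof -
  let ?t = "F.N.val u"
  have t: "?t \<in> carrier N" by (rule F.N.val_closed[OF u])
  note r = rung[OF t] and r' = rung'[OF t]
  have "(u @ [] @ [], u @ (\<rho> ?t @ \<rho>' ?t) @ []) \<in> F.N.move (scale K)"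
  proof (rule F.N.moveI)
    show "length (\<rho> ?t @ \<rho>' ?t) \<le> scale K" using r r' scale_ge(2)[of K] by simp
    have "F.N.val (u @ \<rho> ?t @ \<rho>' ?t) = ?t"
      using r r' t u by (simp add: F.N.m_assoc[symmetric] del: in_lists_conv_set)
    then show "F.N.val (u @ []) = F.N.val (u @ \<rho> ?t @ \<rho>' ?t)" by simp
  qed (use u r r' in auto)
  then have "(u, (u @ \<rho> ?t) @ \<rho>' ?t) \<in> F.N.move (scale K) ^^ 1" by simp
  from relpow_trans[OF this F.N.move_relpow_append[OF ladder[OF u] conjunct1[OF r']]]
  show ?thesis by simp
qed

text \<open>Both words are joined to their images by ladders, and the moves in \<open>M\<close> are
  mapped forward in between. The returning rung is the same for both, since it depends only on the
  common value.\<close>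

lemma transport_moves:
  assumes u: "u \<in> F.N.words" and v: "v \<in> F.N.words" and eq: "F.N.val u = F.N.val v"
    and moves: "(G.path u, G.path v) \<in> F.M.move K ^^ k"
  shows "(u, v) \<in> F.N.move (scale K) ^^ (k + (length u + length v) + 4)"
proof -
  let ?\<rho> = "\<rho>' (F.N.val u)"
  have r: "?\<rho> \<in> F.N.words" using rung'[OF F.N.val_closed[OF u]] by blast
  have 1: "(u, F.path (G.path u) @ ?\<rho>) \<in> F.N.move (scale K) ^^ (length u + 2)"
    by (rule ladder_closed[OF u])
  have 2: "(F.path (G.path u) @ ?\<rho>, F.path (G.path v) @ ?\<rho>) \<in> F.N.move (scale K) ^^ k"
    by (rule F.N.move_relpow_append[OF F.move_relpow_path[OF scale_ge(1) moves] r])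
  have 3: "(F.path (G.path v) @ ?\<rho>, v) \<in> F.N.move (scale K) ^^ (length v + 2)"
    using sym_relpow[OF F.N.sym_move ladder_closed[OF v]] unfolding eq .
  have "length u + 2 + (k + (length v + 2)) = k + (length u + length v) + 4" by simp
  then show ?thesis using relpow_trans[OF 1 relpow_trans[OF 2 3]] by metis
qed

end

section \<open>The directed word metric\<close>

lemma (in monoid) mprod_closed: "A \<subseteq> carrier G \<Longrightarrow> w \<in> lists A \<Longrightarrow> mprod G w \<in> carrier G"
  by (induction w) (auto simp: mprod_def)

lemma (in monoid) mprod_append:
  assumes "A \<subseteq> carrier G" "u \<in> lists A" "v \<in> lists A"
  shows "mprod G (u @ v) = mprod G u \<otimes> mprod G v"
  using assms(2)
proof (induction u)
  case Nil
  then show ?case using mprod_closed[OF assms(1,3)] by (simp add: mprod_def)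
next
  case (Cons a u)
  then have a: "a \<in> carrier G" "u \<in> lists A" using assms(1) by auto
  then show ?case using Cons.IH mprod_closed[OF assms(1) a(2)] mprod_closed[OF assms(1,3)]
    by (simp add: mprod_def m_assoc)
qed

lemma mdist_leI: "w \<in> lists A \<Longrightarrow> x \<otimes>\<^bsub>M\<^esub> mprod M w = y \<Longrightarrow> mdist M A x y \<le> enat (length w)"
  unfolding mdist_def by (intro Inf_lower CollectI exI[of _ w]) simp

text \<open>A finite bound excludes the empty infimum, which is \<infinity>, and a nonempty infimum
  of extended naturals is attained.\<close>

lemma mdist_leE:
  assumes "mdist M A x y \<le> enat k"
  obtains w where "w \<in> lists A" "length w \<le> k" "x \<otimes>\<^bsub>M\<^esub> mprod M w = y"
proof -
  let ?S = "{enat (length w) | w. w \<in> lists A \<and> x \<otimes>\<^bsub>M\<^esub> mprod M w = y}"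
  have "?S \<noteq> {}"
  proof
    assume "?S = {}"
    then have "mdist M A x y = \<infinity>" unfolding mdist_def Inf_enat_def by (simp only: simp_thms if_True)
    then show False using assms by simp
  qed
  then obtain d where "d \<in> ?S" by (meson ex_in_conv)
  then have "Inf ?S \<in> ?S" by (rule wellorder_InfI)
  then show thesis
  proof (rule CollectE, elim exE conjE)
    fix w assume "Inf ?S = enat (length w)" "w \<in> lists A" "x \<otimes>\<^bsub>M\<^esub> mprod M w = y"
    then show thesis using that[of w] assms unfolding mdist_def by simp
  qed
qed

lemma (in monoid) mdist_trans:
  assumes A: "A \<subseteq> carrier G" and x: "x \<in> carrier G"
    and "mdist G A x y \<le> enat i" "mdist G A y z \<le> enat j"
  shows "mdist G A x z \<le> enat (i + j)"
proof -
  obtain u where u: "u \<in> lists A" "length u \<le> i" "x \<otimes> mprod G u = y" using assms(3) by (rule mdist_leE)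
  obtain v where v: "v \<in> lists A" "length v \<le> j" "y \<otimes> mprod G v = z" using assms(4) by (rule mdist_leE)
  have uv: "u @ v \<in> lists A" using u v by simp
  have "x \<otimes> mprod G (u @ v) = z"
    using mprod_append[OF A u(1) v(1)] mprod_closed[OF A u(1)] mprod_closed[OF A v(1)] x u v
    by (simp add: m_assoc[symmetric])
  from mdist_leI[OF uv this] show ?thesis using u v by (simp add: order_trans)
qed

lemma ereal_of_enat_le_ereal_iff:
  "ereal_of_enat d \<le> ereal c \<longleftrightarrow> (\<exists>k. d = enat k \<and> real k \<le> c)"
  by (cases d) auto

text \<open>Distances are integers, so the real constants of a quasi-isometry can be rounded down to
  natural numbers.\<close>

lemma le_ereal_imp_le_enat: "ereal_of_enat d \<le> ereal c \<Longrightarrow> d \<le> enat (nat \<lfloor>c\<rfloor>)"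
  by (auto simp: ereal_of_enat_le_ereal_iff le_nat_floor)

context marked_monoid
begin

text \<open>Spelling each element of \<open>A\<close> in the marked generators changes lengths by at
  most a factor; the total length of these spellings is such a factor.\<close>

lemma words_of_mdist:
  assumes A: "finite A" "A \<subseteq> carrier M"
  obtains c where "\<And>x y k. x \<in> carrier M \<Longrightarrow> mdist M A x y \<le> enat k \<Longrightarrow>
    \<exists>w\<in>words. length w \<le> c * k \<and> x \<otimes> val w = y"
proof -
  define \<tau> where "\<tau> a = (SOME w. w \<in> words \<and> val w = a)" for a
  have \<tau>: "\<tau> a \<in> words \<and> val (\<tau> a) = a" if "a \<in> A" for a
  proof -
    have "\<exists>w. w \<in> words \<and> val w = a" using val_surj[of a] A(2) that by blast
    from someI_ex[OF this] show ?thesis unfolding \<tau>_def .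
  qed
  let ?c = "\<Sum>a\<in>A. length (\<tau> a)"
  have len: "length (\<tau> a) \<le> ?c" if "a \<in> A" for a
    using member_le_sum[OF that, of "\<lambda>a. length (\<tau> a)"] A(1) by simp
  have conc: "concat (map \<tau> w) \<in> words \<and> val (concat (map \<tau> w)) = mprod M w \<and>
      length (concat (map \<tau> w)) \<le> ?c * length w" if "w \<in> lists A" for w
    using that
  proof (induction w)
    case (Cons a w)
    then have a: "a \<in> A" and IH: "concat (map \<tau> w) \<in> words" "val (concat (map \<tau> w)) = mprod M w"
      "length (concat (map \<tau> w)) \<le> ?c * length w" by auto
    have "\<tau> a @ concat (map \<tau> w) \<in> words" using \<tau>[OF a] IH(1) by simp
    moreover have "val (\<tau> a @ concat (map \<tau> w)) = mprod M (a # w)"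
      using val_append[OF conjunct1[OF \<tau>[OF a]] IH(1)] \<tau>[OF a] IH(2) by (simp add: mprod_def)
    ultimately show ?case using len[OF a] IH(3) by simp
  qed (simp add: mprod_def)
  show thesis
  proof (rule that)
    fix x y k assume "x \<in> carrier M" and d: "mdist M A x y \<le> enat k"
    obtain w where w: "w \<in> lists A" "length w \<le> k" "x \<otimes> mprod M w = y" using d by (rule mdist_leE)
    have "length (concat (map \<tau> w)) \<le> ?c * k"
      using conc[OF w(1)] mult_le_mono2[OF w(2), of ?c] by linarith
    then show "\<exists>w\<in>words. length w \<le> ?c * k \<and> x \<otimes> val w = y"
      using conc[OF w(1)] w(3) by (intro bexI[of _ "concat (map \<tau> w)"]) auto
  qed
qed

lemma mdist_generator_bound:
  assumes "generates M A"
  obtains c where "\<And>x i. i < n \<Longrightarrow> mdist M A x (x \<otimes> g i) \<le> enat c"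
proof -
  have "\<exists>w. w \<in> lists A \<and> mprod M w = g i" if "i < n" for i
    using assms g_closed[OF that] unfolding generates_def by blast
  then obtain \<tau> where \<tau>: "\<And>i. i < n \<Longrightarrow> \<tau> i \<in> lists A \<and> mprod M (\<tau> i) = g i" by metis
  show thesis
  proof (rule that)
    fix x i assume i: "i < n"
    have "length (\<tau> i) \<le> (\<Sum>i<n. length (\<tau> i))"
      using member_le_sum[of i "{..<n}" "\<lambda>i. length (\<tau> i)"] i by simp
    moreover have "mdist M A x (x \<otimes> g i) \<le> enat (length (\<tau> i))"
      using \<tau>[OF i] by (intro mdist_leI) auto
    ultimately show "mdist M A x (x \<otimes> g i) \<le> enat (\<Sum>i<n. length (\<tau> i))"
      by (simp add: order_trans)
  qed
qed

end

lemma marked_monoid_of_generates: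
  fixes M :: "('a, 'b) monoid_scheme"
  assumes "monoid M" "finite A" "generates M A"
  obtains n g where "marked_monoid M n g"
proof -
  obtain n and g :: "nat \<Rightarrow> 'a" where g: "A = g ` {i. i < n}"
    using finite_imp_nat_seg_image_inj_on[OF assms(2)] by blast
  have "\<exists>w\<in>lists {..<n}. mprod M (map g w) = x" if x: "x \<in> carrier M" for x
  proof -
    obtain w where w: "w \<in> lists A" "mprod M w = x" using assms(3) x unfolding generates_def by blast
    have "w \<in> map g ` lists {..<n}" using w(1) by (simp add: lists_image[symmetric] g lessThan_def)
    then show ?thesis using w(2) by blast
  qed
  moreover have "g i \<in> carrier M" if "i < n" for i
    using assms(3) that unfolding generates_def g by blast
  ultimately have "marked_monoid M n g"
    using assms(1) by (simp add: marked_monoid_def marked_monoid_axioms_def)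
  then show thesis by (rule that)
qed

section \<open>Quasi-isometries as coarse equivalences\<close>

text \<open>The upper estimate gives the edge paths of \<open>f\<close>. Quasi-density gives
  \<open>f'\<close> and the rungs, and the lower estimate gives the edge paths of
  \<open>f'\<close>.\<close>

lemma qi_map_coarse_equivalence:
  fixes M :: "('a, 'b) monoid_scheme" and N :: "('c, 'd) monoid_scheme"
  assumes M: "marked_monoid M m g" and N: "marked_monoid N n h"
    and A: "finite A" "generates M A" and B: "finite B" "generates N B" and qi: "qi_map M A N B f"
  shows "\<exists>\<phi> C f' \<gamma> \<rho> \<rho>'. coarse_equivalence M m g N n h f \<phi> C f' \<gamma> \<rho> \<rho>'"
proof -
  interpret M: marked_monoid M m g by (rule M)
  interpret N: marked_monoid N n h by (rule N)
  have AM: "A \<subseteq> carrier M" and BN: "B \<subseteq> carrier N" using A B by (auto simp: generates_def)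
  have f: "f x \<in> carrier N" if "x \<in> carrier M" for x
    using qi that unfolding qi_map_def by blast
  obtain lam \<epsilon> \<mu> :: real where const: "1 \<le> lam" "0 < \<epsilon>" "0 \<le> \<mu>"
    and bounds: "\<forall>x\<in>carrier M. \<forall>y\<in>carrier M.
      ereal (1 / lam) * ereal_of_enat (mdist M A x y) - ereal \<epsilon> \<le> ereal_of_enat (mdist N B (f x) (f y)) \<and>
      ereal_of_enat (mdist N B (f x) (f y)) \<le> ereal lam * ereal_of_enat (mdist M A x y) + ereal \<epsilon>"
    and dense: "\<forall>t\<in>carrier N. \<exists>x\<in>carrier M.
      max (ereal_of_enat (mdist N B t (f x))) (ereal_of_enat (mdist N B (f x) t)) \<le> ereal \<mu>"
    using qi unfolding qi_map_def by (elim conjE exE)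
  have lower: "ereal (1 / lam) * ereal_of_enat (mdist M A x y) - ereal \<epsilon> \<le> ereal_of_enat (mdist N B (f x) (f y))"
    and upper: "ereal_of_enat (mdist N B (f x) (f y)) \<le> ereal lam * ereal_of_enat (mdist M A x y) + ereal \<epsilon>"
    if "x \<in> carrier M" "y \<in> carrier M" for x y
    using bounds that by auto
  have up: "mdist N B (f x) (f y) \<le> enat (nat \<lfloor>lam * real k + \<epsilon>\<rfloor>)"
    if xy: "x \<in> carrier M" "y \<in> carrier M" and d: "mdist M A x y \<le> enat k" for x y k
  proof -
    obtain j where j: "mdist M A x y = enat j" "j \<le> k" using d by (cases "mdist M A x y") auto
    have "lam * real j \<le> lam * real k" using j const by (intro mult_left_mono) auto
    then have "ereal_of_enat (mdist N B (f x) (f y)) \<le> ereal (lam * real k + \<epsilon>)"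
      using upper[OF xy] j by (auto intro: order_trans)
    then show ?thesis by (rule le_ereal_imp_le_enat)
  qed
  have low: "mdist M A x y \<le> enat (nat \<lfloor>lam * (real k + \<epsilon>)\<rfloor>)"
    if xy: "x \<in> carrier M" "y \<in> carrier M" and d: "mdist N B (f x) (f y) \<le> enat k" for x y k
  proof -
    obtain j where j: "mdist N B (f x) (f y) = enat j" "j \<le> k"
      using d by (cases "mdist N B (f x) (f y)") auto
    \<comment> \<open>An infinite distance in \<open>M\<close> would by the lower estimate force an
      infinite one in \<open>N\<close>.\<close>
    obtain i where i: "mdist M A x y = enat i"
      using lower[OF xy] j const by (cases "mdist M A x y") auto
    have "real i / lam - \<epsilon> \<le> real j" using lower[OF xy] i j by simp
    then have "real i / lam \<le> real k + \<epsilon>" using j by simp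
    then have "real i \<le> lam * (real k + \<epsilon>)" using const by (simp add: field_simps)
    then show ?thesis using i by (intro le_ereal_imp_le_enat) simp
  qed
  define r where "r = nat \<lfloor>\<mu>\<rfloor>"
  have "\<exists>x\<in>carrier M. mdist N B t (f x) \<le> enat r \<and> mdist N B (f x) t \<le> enat r"
    if t: "t \<in> carrier N" for t
    using bspec[OF dense t] unfolding r_def by (auto dest: le_ereal_imp_le_enat)
  then obtain f' where f': "\<And>t. t \<in> carrier N \<Longrightarrow> f' t \<in> carrier M \<and>
      mdist N B t (f (f' t)) \<le> enat r \<and> mdist N B (f (f' t)) t \<le> enat r" by metis
  obtain a where a: "\<And>x i. i < m \<Longrightarrow> mdist M A x (x \<otimes>\<^bsub>M\<^esub> g i) \<le> enat a"
    by (rule M.mdist_generator_bound[OF A(2)]) blast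
  obtain b where b: "\<And>x i. i < n \<Longrightarrow> mdist N B x (x \<otimes>\<^bsub>N\<^esub> h i) \<le> enat b"
    by (rule N.mdist_generator_bound[OF B(2)]) blast
  obtain cM where cM: "\<And>x y k. x \<in> carrier M \<Longrightarrow> mdist M A x y \<le> enat k \<Longrightarrow>
    \<exists>w\<in>M.words. length w \<le> cM * k \<and> x \<otimes>\<^bsub>M\<^esub> M.val w = y"
    by (rule M.words_of_mdist[OF A(1) AM]) blast
  obtain cN where cN: "\<And>x y k. x \<in> carrier N \<Longrightarrow> mdist N B x y \<le> enat k \<Longrightarrow>
    \<exists>w\<in>N.words. length w \<le> cN * k \<and> x \<otimes>\<^bsub>N\<^esub> N.val w = y"
    by (rule N.words_of_mdist[OF B(1) BN]) blast
  define kF where "kF = nat \<lfloor>lam * real a + \<epsilon>\<rfloor>"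
  \<comment> \<open>\<open>r + (b + r)\<close> is the length of the route from
    \<open>f (f' t)\<close> to \<open>t\<close>, along one generator, and on to the image of the new
    vertex; the lower estimate pulls it back to \<open>M\<close>.\<close>
  define kG where "kG = nat \<lfloor>lam * (real (r + (b + r)) + \<epsilon>)\<rfloor>"
  define C where "C = cN * kF + cM * kG + cN * r"
  have "\<exists>w\<in>N.words. length w \<le> C \<and> f x \<otimes>\<^bsub>N\<^esub> N.val w = f (x \<otimes>\<^bsub>M\<^esub> g i)"
    if x: "x \<in> carrier M" and i: "i < m" for x i
  proof -
    have "mdist N B (f x) (f (x \<otimes>\<^bsub>M\<^esub> g i)) \<le> enat kF"
      unfolding kF_def using x M.g_closed[OF i] a[OF i] by (intro up) auto
    from cN[OF f[OF x] this] obtain w where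
      "w \<in> N.words" "length w \<le> cN * kF" "f x \<otimes>\<^bsub>N\<^esub> N.val w = f (x \<otimes>\<^bsub>M\<^esub> g i)" by blast
    then show ?thesis unfolding C_def by (intro bexI[of _ w]) auto
  qed
  then obtain \<phi> where \<phi>: "\<And>x i. x \<in> carrier M \<Longrightarrow> i < m \<Longrightarrow> \<phi> x i \<in> N.words \<and> length (\<phi> x i) \<le> C \<and>
    f x \<otimes>\<^bsub>N\<^esub> N.val (\<phi> x i) = f (x \<otimes>\<^bsub>M\<^esub> g i)" by metis
  have "\<exists>w\<in>M.words. length w \<le> C \<and> f' t \<otimes>\<^bsub>M\<^esub> M.val w = f' (t \<otimes>\<^bsub>N\<^esub> h i)"
    if t: "t \<in> carrier N" and i: "i < n" for t i
  proof -
    have t': "t \<otimes>\<^bsub>N\<^esub> h i \<in> carrier N" using t N.g_closed[OF i] by simp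
    have "mdist N B t (f (f' (t \<otimes>\<^bsub>N\<^esub> h i))) \<le> enat (b + r)"
      using f'[OF t'] by (intro N.mdist_trans[OF BN t b[OF i]]) blast
    then have "mdist N B (f (f' t)) (f (f' (t \<otimes>\<^bsub>N\<^esub> h i))) \<le> enat (r + (b + r))"
      using f'[OF t] f[of "f' t"] by (elim N.mdist_trans[OF BN, rotated 2]) blast+
    then have "mdist M A (f' t) (f' (t \<otimes>\<^bsub>N\<^esub> h i)) \<le> enat kG"
      unfolding kG_def using f'[OF t] f'[OF t'] by (intro low) auto
    from cM[OF _ this] f'[OF t] obtain w where
      "w \<in> M.words" "length w \<le> cM * kG" "f' t \<otimes>\<^bsub>M\<^esub> M.val w = f' (t \<otimes>\<^bsub>N\<^esub> h i)" by blast
    then show ?thesis unfolding C_def by (intro bexI[of _ w]) auto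
  qed
  then obtain \<gamma> where \<gamma>: "\<And>t i. t \<in> carrier N \<Longrightarrow> i < n \<Longrightarrow> \<gamma> t i \<in> M.words \<and> length (\<gamma> t i) \<le> C \<and>
    f' t \<otimes>\<^bsub>M\<^esub> M.val (\<gamma> t i) = f' (t \<otimes>\<^bsub>N\<^esub> h i)" by metis
  have short: "\<exists>w\<in>N.words. length w \<le> C \<and> t \<otimes>\<^bsub>N\<^esub> N.val w = t'"
    if t: "t \<in> carrier N" and d: "mdist N B t t' \<le> enat r" for t t'
  proof -
    obtain w where "w \<in> N.words" "length w \<le> cN * r" "t \<otimes>\<^bsub>N\<^esub> N.val w = t'" using cN[OF t d] by blast
    then show ?thesis unfolding C_def by (intro bexI[of _ w]) auto
  qed
  have "\<exists>w\<in>N.words. length w \<le> C \<and> t \<otimes>\<^bsub>N\<^esub> N.val w = f (f' t)" if t: "t \<in> carrier N" for t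
    using short f'[OF t] t by blast
  then obtain \<rho> where \<rho>: "\<And>t. t \<in> carrier N \<Longrightarrow> \<rho> t \<in> N.words \<and> length (\<rho> t) \<le> C \<and>
    t \<otimes>\<^bsub>N\<^esub> N.val (\<rho> t) = f (f' t)" by metis
  have "\<exists>w\<in>N.words. length w \<le> C \<and> f (f' t) \<otimes>\<^bsub>N\<^esub> N.val w = t" if t: "t \<in> carrier N" for t
    using short[of "f (f' t)" t] f'[OF t] f by blast
  then obtain \<rho>' where \<rho>': "\<And>t. t \<in> carrier N \<Longrightarrow> \<rho>' t \<in> N.words \<and> length (\<rho>' t) \<le> C \<and>
    f (f' t) \<otimes>\<^bsub>N\<^esub> N.val (\<rho>' t) = t" by metis
  have F: "coarse_map M m g N n h f \<phi> C"
    by (intro coarse_map.intro coarse_map_axioms.intro M N f \<phi>)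
  have G: "coarse_map N n h M m g f' \<gamma> C"
    by (intro coarse_map.intro coarse_map_axioms.intro M N \<gamma>) (use f' in blast)
  have "coarse_equivalence M m g N n h f \<phi> C f' \<gamma> \<rho> \<rho>'"
    by (intro coarse_equivalence.intro coarse_equivalence_axioms.intro F G \<rho> \<rho>')
  then show ?thesis by blast
qed

section \<open>Finite presentations with solvable word problem, and the conclusion\<close>

lemma (in marked_monoid) fp_solvable_wpI:
  assumes "presents R" "decidable_set word_problem"
  shows "fp_solvable_wp M"
  unfolding fp_solvable_wp_def
proof (intro exI conjI)
  show "g ` {..<n} \<subseteq> carrier M" using g_closed by auto
  show "\<forall>x\<in>carrier M. \<exists>w\<in>words. mprod M (map g w) = x" using g_generates by blast
  show "finite R" "R \<subseteq> words \<times> words"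
    "\<forall>u\<in>words. \<forall>v\<in>words. mprod M (map g u) = mprod M (map g v) \<longleftrightarrow> (u, v) \<in> cong_gen R"
    using assms(1) unfolding presents_def val_def by blast+
  show "decidable_set {prod_encode (list_encode u, list_encode v) | u v.
      u \<in> words \<and> v \<in> words \<and> mprod M (map g u) = mprod M (map g v)}"
    using assms(2) unfolding word_problem_def val_def .
qed

lemma fp_solvable_wpE:
  assumes "monoid M" "fp_solvable_wp M"
  obtains n g R where "marked_monoid M n g" "marked_monoid.presents M n g R"
    "decidable_set (marked_monoid.word_problem M n g)"
proof -
  from assms(2) obtain n g R where *: "g ` {..<n} \<subseteq> carrier M"
    "\<forall>x\<in>carrier M. \<exists>w\<in>lists {..<n}. mprod M (map g w) = x"
    "finite R" "R \<subseteq> lists {..<n} \<times> lists {..<n}"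
    "\<forall>u\<in>lists {..<n}. \<forall>v\<in>lists {..<n}. mprod M (map g u) = mprod M (map g v) \<longleftrightarrow> (u, v) \<in> cong_gen R"
    "decidable_set {prod_encode (list_encode u, list_encode v) | u v.
       u \<in> lists {..<n} \<and> v \<in> lists {..<n} \<and> mprod M (map g u) = mprod M (map g v)}"
    unfolding fp_solvable_wp_def by (elim exE conjE)
  interpret marked_monoid M n g
    by (intro marked_monoid.intro assms(1) marked_monoid_axioms.intro) (use *(1,2) in auto)
  show thesis
  proof (rule that)
    show "presents R" using *(3-5) unfolding presents_def val_def by blast
    show "decidable_set word_problem" using *(6) unfolding word_problem_def val_def .
  qed (rule marked_monoid_axioms)
qed

theorem theorem5p8:
  fixes M :: "('a, 'b) monoid_scheme" and N :: "('c, 'd) monoid_scheme"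
  assumes "monoid M" and "monoid N"
    and "finitely_generated M" and "finitely_generated N"
    and "finite (left_ideals M)" and "finite (right_ideals M)"
    and "finite (left_ideals N)" and "finite (right_ideals N)"
    and "quasi_isometric M N"
    and "fp_solvable_wp M"
  shows "fp_solvable_wp N"
proof -
  \<comment> \<open>\<open>M\<close> is marked by the generators of its presentation, which may
    differ from the set \<open>A\<close> of the quasi-isometry.\<close>
  obtain m g R where M: "marked_monoid M m g" and R: "marked_monoid.presents M m g R"
    and wp: "decidable_set (marked_monoid.word_problem M m g)"
    using assms(1,10) by (rule fp_solvable_wpE)
  from assms(9) obtain A B f where A: "finite A" "generates M A" and B: "finite B" "generates N B"
    and qi: "qi_map M A N B f" unfolding quasi_isometric_def by (elim exE conjE)
  obtain n h where N: "marked_monoid N n h" by (rule marked_monoid_of_generates[OF assms(2) B])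
  obtain \<phi> C f' \<gamma> \<rho> \<rho>' where "coarse_equivalence M m g N n h f \<phi> C f' \<gamma> \<rho> \<rho>'"
    using qi_map_coarse_equivalence[OF M N A B qi] by blast
  then interpret coarse_equivalence M m g N n h f \<phi> C f' \<gamma> \<rho> \<rho>' .
  obtain D where D: "computable 1 (\<lambda>xs. D (xs ! 0))"
    and Dehn: "\<And>u v l. \<lbrakk>u \<in> F.M.words; v \<in> F.M.words; F.M.val u = F.M.val v; length u \<le> l; length v \<le> l\<rbrakk>
      \<Longrightarrow> (u, v) \<in> sstep R ^^ D l"
    by (rule F.M.computable_Dehn_bound[OF R wp]) blast
  have R': "finite R" "R \<subseteq> F.M.words \<times> F.M.words" using R unfolding F.M.presents_def by blast+
  have R_sound: "F.M.val l = F.M.val r" if lr: "(l, r) \<in> R" for l r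
  proof -
    have "(l, r) \<in> sstep R ^^ 1" using sstep_rule[OF lr, of "[]" "[]"] by simp
    then have "(l, r) \<in> cong_gen R" unfolding cong_gen_eq_relpow by blast
    then show ?thesis using R subsetD[OF R'(2) lr] unfolding F.M.presents_def by blast
  qed
  obtain K where K: "\<And>l r. (l, r) \<in> R \<Longrightarrow> length l \<le> K \<and> length r \<le> K"
    by (rule rule_length_bound[OF R'(1)]) blast
  \<comment> \<open>\<open>S\<close> is the candidate presentation of \<open>N\<close>; the finitely
    many left ideals of \<open>N\<close> enter here.\<close>
  obtain S where S: "finite S" "S \<subseteq> F.N.words \<times> F.N.words" "\<And>l r. (l, r) \<in> S \<Longrightarrow> F.N.val l = F.N.val r"
    and S_move: "\<And>u v. (u, v) \<in> F.N.move (scale K) \<Longrightarrow> (u, v) \<in> sstep S ^^ (2 * length u + 3)"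
    by (rule F.N.moves_by_finite_relations[OF assms(7), of "scale K"]) blast
  \<comment> \<open>For words of total length \<open>l\<close>, \<open>J\<close> counts moves: the
    derivation bound for their image paths in \<open>M\<close>, plus the two ladders.
    \<open>E\<close> multiplies this by the cost of a move in relations of \<open>S\<close>.\<close>
  define J where "J l = D (length G.base + C * l) + l + 4" for l
  define E where "E l = J l * (2 * (l + scale K * J l) + 3)" for l
  have E: "computable 1 (\<lambda>xs. E (xs ! 0))"
    unfolding E_def J_def by (intro computable_intros computable_compose1[OF D]) simp_all
  have Dehn_N: "(u, v) \<in> sstep S ^^ E (length u + length v)"
    if u: "u \<in> F.N.words" and v: "v \<in> F.N.words" and eq: "F.N.val u = F.N.val v" for u v
  proof -
    let ?l = "length u + length v"
    have "(G.path u, G.path v) \<in> sstep R ^^ D (length G.base + C * ?l)"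
    proof (rule Dehn)
      show "G.path u \<in> F.M.words" "G.path v \<in> F.M.words" using G.path_words u v by blast+
      show "F.M.val (G.path u) = F.M.val (G.path v)" using G.val_path u v eq by metis
      show "length (G.path u) \<le> length G.base + C * ?l" "length (G.path v) \<le> length G.base + C * ?l"
        using G.length_path[OF u] G.length_path[OF v] by (auto simp: distrib_left)
    qed
    then have "(G.path u, G.path v) \<in> F.M.move K ^^ D (length G.base + C * ?l)"
      using F.M.sstep_relpow_imp_move[OF R'(2) K R_sound _ G.path_words[OF u]] by blast
    from transport_moves[OF u v eq this] have moves: "(u, v) \<in> F.N.move (scale K) ^^ J ?l"
      by (simp add: J_def)
    have "J ?l * (2 * (length u + scale K * J ?l) + 3) \<le> E ?l"
      unfolding E_def by (intro mult_le_mono2) simp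
    then show ?thesis
      by (rule sstep_relpow_mono[OF _ F.N.relpow_move_imp_sstep[OF S_move moves]])
  qed
  \<comment> \<open>The length bound gives completeness of \<open>S\<close> as well as the decision
    procedure.\<close>
  have "F.N.presents S"
    unfolding F.N.presents_def
  proof (intro conjI ballI iffI S(1,2))
    fix u v assume u: "u \<in> F.N.words" and v: "v \<in> F.N.words"
    show "(u, v) \<in> cong_gen S" if "F.N.val u = F.N.val v"
      using Dehn_N[OF u v that] unfolding cong_gen_eq_relpow by blast
    show "F.N.val u = F.N.val v" if "(u, v) \<in> cong_gen S"
      using that F.N.sound_sstep_relpow[OF S(2,3) _ u] unfolding cong_gen_eq_relpow by blast
  qed
  then show ?thesis
    by (rule F.N.fp_solvable_wpI) (rule F.N.decidable_word_problem[OF S E Dehn_N])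
qed

end
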